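(* Let $\boldsymbol{X}_1,\dots,\boldsymbol{X}_n$ be i.i.d. from a distribution $G$ with density $g$ (not necessarily in the model), and let $\widehat{\boldsymbol{\theta}}_{\beta,g}=\boldsymbol{T}_\beta(G_n)$ be the minimum density power divergence estimator with tuning parameter $\beta$, $G_n$ being the empirical distribution. Under the composite null hypothesis $H_0:\boldsymbol{m}(\boldsymbol{T}_\beta(G))=\boldsymbol{0}_r$, with $\boldsymbol{\theta}_0=\boldsymbol{T}_\beta(G)$, $$W_n(\widehat{\boldsymbol{\theta}}_{\beta,g})=n\,\boldsymbol{m}^T(\widehat{\boldsymbol{\theta}}_{\beta,g})\left(\boldsymbol{M}^T(\widehat{\boldsymbol{\theta}}_{\beta,g})\boldsymbol{\Sigma}_\beta(\widehat{\boldsymbol{\theta}}_{\beta,g})\boldsymbol{M}(\widehat{\boldsymbol{\theta}}_{\beta,g})\right)^{-1}\boldsymbol{m}(\widehat{\boldsymbol{\theta}}_{\beta,g})\ \underset{n\to\infty}{\overset{\mathcal{L}}{\longrightarrow}}\ \sum_{i=1}^rc_{i,\beta,g}^\ast(\boldsymbol{\theta}_0)Z_i^2,$$ where $\{Z_i\}_{i=1}^r$ are i.i.d. standard normal random variables and $\{c_{i,\beta,g}^\ast(\boldsymbol{\theta}_0)\}_{i=1}^r$ is the set of eigenvalues of $\boldsymbol{\Sigma}_\beta^{\ast-1}(\boldsymbol{\theta}_0)\boldsymbol{\Sigma}_{\beta,g}^\ast(\boldsymbol{\theta}_0)$, with $\boldsymbol{\Sigma}_\beta^\ast=\boldsymbol{M}^T\boldsymbol{\Sigma}_\beta\boldsymbol{M}$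 and $\boldsymbol{\Sigma}_{\beta,g}^\ast=\boldsymbol{M}^T\boldsymbol{\Sigma}_{\beta,g}\boldsymbol{M}$.
   Context: $\{f_{\boldsymbol{\theta}}:\boldsymbol{\theta}\in\Theta\subset\mathbb{R}^p\}$ is a parametric family of densities with respect to a dominating measure, written $d\boldsymbol{x}$; $\beta\ge0$. Put $\boldsymbol{u}_{\boldsymbol{\theta}}(\boldsymbol{x})=\frac{\partial}{\partial\boldsymbol{\theta}}\log f_{\boldsymbol{\theta}}(\boldsymbol{x})$, $\boldsymbol{I}_{\boldsymbol{\theta}}(\boldsymbol{x})=-\frac{\partial}{\partial\boldsymbol{\theta}}\boldsymbol{u}_{\boldsymbol{\theta}}^T(\boldsymbol{x})$, $\boldsymbol{\xi}_\beta(\boldsymbol{\theta})=\int\boldsymbol{u}_{\boldsymbol{\theta}}f_{\boldsymbol{\theta}}^{1+\beta}d\boldsymbol{x}$, $\boldsymbol{J}_\beta(\boldsymbol{\theta})=\int\boldsymbol{u}_{\boldsymbol{\theta}}\boldsymbol{u}_{\boldsymbol{\theta}}^Tf_{\boldsymbol{\theta}}^{1+\beta}d\boldsymbol{x}$, $\boldsymbol{K}_\beta(\boldsymbol{\theta})=\int\boldsymbol{u}_{\boldsymbol{\theta}}\boldsymbol{u}_{\boldsymbol{\theta}}^Tf_{\boldsymbol{\theta}}^{1+2\beta}d\boldsymbol{x}-\boldsymbol{\xi}_\beta\boldsymbol{\xi}_\beta^T$, $\boldsymbol{\Sigma}_\beta=\boldsymbol{J}_\beta^{-1}\boldsymbol{K}_\beta\boldsymbol{J}_\beta^{-1}$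 (continuous near $\boldsymbol{\theta}_0$; the matrices whose inverses appear are invertible), and $$\boldsymbol{J}_{\beta,g}(\boldsymbol{\theta})=\int\boldsymbol{u}_{\boldsymbol{\theta}}\boldsymbol{u}_{\boldsymbol{\theta}}^Tf_{\boldsymbol{\theta}}^{1+\beta}d\boldsymbol{x}+\int(\boldsymbol{I}_{\boldsymbol{\theta}}-\beta\boldsymbol{u}_{\boldsymbol{\theta}}\boldsymbol{u}_{\boldsymbol{\theta}}^T)(g-f_{\boldsymbol{\theta}})f_{\boldsymbol{\theta}}^\beta d\boldsymbol{x},$$ $$\boldsymbol{\xi}_{\beta,g}(\boldsymbol{\theta})=\int\boldsymbol{u}_{\boldsymbol{\theta}}f_{\boldsymbol{\theta}}^\beta g\,d\boldsymbol{x},\qquad\boldsymbol{K}_{\beta,g}(\boldsymbol{\theta})=\int\boldsymbol{u}_{\boldsymbol{\theta}}\boldsymbol{u}_{\boldsymbol{\theta}}^Tf_{\boldsymbol{\theta}}^{2\beta}g\,d\boldsymbol{x}-\boldsymbol{\xi}_{\beta,g}\boldsymbol{\xi}_{\beta,g}^T,\qquad\boldsymbol{\Sigma}_{\beta,g}=\boldsymbol{J}_{\beta,g}^{-1}\boldsymbol{K}_{\beta,g}\boldsymbol{J}_{\beta,g}^{-1}.$$ $\boldsymbol{m}:\mathbb{R}^p\to\mathbb{R}^r$ with $r\le p$; the $p\times r$ matrix $\boldsymbol{M}(\boldsymbol{\theta})=\partial\boldsymbol{m}^T(\boldsymbol{\theta})/\partial\boldsymbol{\theta}$ exists and is continuous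 in a neighbourhood of $\boldsymbol{\theta}_0$, and $\operatorname{rank}\boldsymbol{M}(\boldsymbol{\theta}_0)=r$. $\boldsymbol{T}_\beta(G)$ is the minimizer over $\boldsymbol{\theta}\in\Theta$ of $\int f_{\boldsymbol{\theta}}^{1+\beta}d\boldsymbol{x}-(1+\frac1\beta)\int f_{\boldsymbol{\theta}}^\beta dG$ if $\beta>0$, and of $-\int\log f_{\boldsymbol{\theta}}\,dG$ if $\beta=0$. Standing fact from the literature, assumed throughout: with $\boldsymbol{\theta}_0=\boldsymbol{T}_\beta(G)$, $n^{1/2}(\widehat{\boldsymbol{\theta}}_{\beta,g}-\boldsymbol{\theta}_0)\overset{\mathcal{L}}{\longrightarrow}\mathcal{N}(\boldsymbol{0}_p,\boldsymbol{\Sigma}_{\beta,g}(\boldsymbol{\theta}_0))$ as $n\to\infty$. *)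

theory Defs
  imports
    "HOL-Probability.Probability"
    "HOL-Computational_Algebra.Polynomial"
begin

(* Family of densities f :: parameter => sample point => real with respect to the dominating
   measure \<mu>.  Integrands carry a factor (f \<theta> x) powr b; as 0 powr b = 0 in Isabelle, also for
   b = 0, points where f \<theta> x = 0, at which the score is undefined, never contribute. *)

definition score :: "(real^'p \<Rightarrow> 'x \<Rightarrow> real) \<Rightarrow> real^'p \<Rightarrow> 'x \<Rightarrow> real^'p" where
  "score f \<theta> x = (\<chi> i. frechet_derivative (\<lambda>t. ln (f t x)) (at \<theta>) (axis i 1))"

(* jacobian h has the entry d h_i / d \<theta>_j at (i, j), whereas (d/d\<theta>) h^T has d h_j / d \<theta>_i. *)
definition deriv_transp :: "(real^'p \<Rightarrow> real^'r) \<Rightarrow> real^'p \<Rightarrow> real^'r^'p" where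
  "deriv_transp h \<theta> = transpose (jacobian h (at \<theta>))"

definition info :: "(real^'p \<Rightarrow> 'x \<Rightarrow> real) \<Rightarrow> real^'p \<Rightarrow> 'x \<Rightarrow> real^'p^'p" where
  "info f \<theta> x = - deriv_transp (\<lambda>t. score f t x) \<theta>"

definition outer :: "real^'p \<Rightarrow> real^'p \<Rightarrow> real^'p^'p" where
  "outer u v = (\<chi> i j. u $ i * v $ j)"

definition xi_model :: "'x measure \<Rightarrow> (real^'p \<Rightarrow> 'x \<Rightarrow> real) \<Rightarrow> real \<Rightarrow> real^'p \<Rightarrow> real^'p" where
  "xi_model \<mu> f \<beta> \<theta> = (\<integral>x. (f \<theta> x powr (1 + \<beta>)) *\<^sub>R score f \<theta> x \<partial>\<mu>)"

definition J_model :: "'x measure \<Rightarrow> (real^'p \<Rightarrow> 'x \<Rightarrow> real) \<Rightarrow> real \<Rightarrow> real^'p \<Rightarrow> real^'p^'p" where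
  "J_model \<mu> f \<beta> \<theta> =
     (\<integral>x. (f \<theta> x powr (1 + \<beta>)) *\<^sub>R outer (score f \<theta> x) (score f \<theta> x) \<partial>\<mu>)"

definition K_model :: "'x measure \<Rightarrow> (real^'p \<Rightarrow> 'x \<Rightarrow> real) \<Rightarrow> real \<Rightarrow> real^'p \<Rightarrow> real^'p^'p" where
  "K_model \<mu> f \<beta> \<theta> =
     (\<integral>x. (f \<theta> x powr (1 + 2 * \<beta>)) *\<^sub>R outer (score f \<theta> x) (score f \<theta> x) \<partial>\<mu>)
     - outer (xi_model \<mu> f \<beta> \<theta>) (xi_model \<mu> f \<beta> \<theta>)"

definition Sigma_model :: "'x measure \<Rightarrow> (real^'p \<Rightarrow> 'x \<Rightarrow> real) \<Rightarrow> real \<Rightarrow> real^'p \<Rightarrow> real^'p^'p" where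
  "Sigma_model \<mu> f \<beta> \<theta> =
     matrix_inv (J_model \<mu> f \<beta> \<theta>) ** K_model \<mu> f \<beta> \<theta> ** matrix_inv (J_model \<mu> f \<beta> \<theta>)"

definition xi_true ::
  "'x measure \<Rightarrow> (real^'p \<Rightarrow> 'x \<Rightarrow> real) \<Rightarrow> real \<Rightarrow> ('x \<Rightarrow> real) \<Rightarrow> real^'p \<Rightarrow> real^'p" where
  "xi_true \<mu> f \<beta> g \<theta> = (\<integral>x. (f \<theta> x powr \<beta> * g x) *\<^sub>R score f \<theta> x \<partial>\<mu>)"

definition J_true ::
  "'x measure \<Rightarrow> (real^'p \<Rightarrow> 'x \<Rightarrow> real) \<Rightarrow> real \<Rightarrow> ('x \<Rightarrow> real) \<Rightarrow> real^'p \<Rightarrow> real^'p^'p" where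
  "J_true \<mu> f \<beta> g \<theta> =
     (\<integral>x. (f \<theta> x powr (1 + \<beta>)) *\<^sub>R outer (score f \<theta> x) (score f \<theta> x) \<partial>\<mu>)
     + (\<integral>x. ((g x - f \<theta> x) * f \<theta> x powr \<beta>) *\<^sub>R
            (info f \<theta> x - \<beta> *\<^sub>R outer (score f \<theta> x) (score f \<theta> x)) \<partial>\<mu>)"

definition K_true ::
  "'x measure \<Rightarrow> (real^'p \<Rightarrow> 'x \<Rightarrow> real) \<Rightarrow> real \<Rightarrow> ('x \<Rightarrow> real) \<Rightarrow> real^'p \<Rightarrow> real^'p^'p" where
  "K_true \<mu> f \<beta> g \<theta> =
     (\<integral>x. (f \<theta> x powr (2 * \<beta>) * g x) *\<^sub>R outer (score f \<theta> x) (score f \<theta> x) \<partial>\<mu>)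
     - outer (xi_true \<mu> f \<beta> g \<theta>) (xi_true \<mu> f \<beta> g \<theta>)"

definition Sigma_true ::
  "'x measure \<Rightarrow> (real^'p \<Rightarrow> 'x \<Rightarrow> real) \<Rightarrow> real \<Rightarrow> ('x \<Rightarrow> real) \<Rightarrow> real^'p \<Rightarrow> real^'p^'p" where
  "Sigma_true \<mu> f \<beta> g \<theta> =
     matrix_inv (J_true \<mu> f \<beta> g \<theta>) ** K_true \<mu> f \<beta> g \<theta> ** matrix_inv (J_true \<mu> f \<beta> g \<theta>)"

(* The objective is extended-real valued, so that log 0 = -\<infinity> and divergent integrals are not
   silently replaced by 0; an indeterminate \<infinity> - \<infinity> evaluates to \<infinity> in ereal. *)
definition dpd_objective ::
  "'x measure \<Rightarrow> (real^'p \<Rightarrow> 'x \<Rightarrow> real) \<Rightarrow> real \<Rightarrow> 'x measure \<Rightarrow> real^'p \<Rightarrow> ereal" where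
  "dpd_objective \<mu> f \<beta> G \<theta> =
     (if \<beta> = 0 then
        enn2ereal (\<integral>\<^sup>+x. (if f \<theta> x = 0 then \<infinity> else ennreal (- ln (f \<theta> x))) \<partial>G)
        - enn2ereal (\<integral>\<^sup>+x. ennreal (ln (f \<theta> x)) \<partial>G)
      else
        enn2ereal (\<integral>\<^sup>+x. ennreal (f \<theta> x powr (1 + \<beta>)) \<partial>\<mu>)
        - ereal (1 + 1 / \<beta>) * enn2ereal (\<integral>\<^sup>+x. ennreal (f \<theta> x powr \<beta>) \<partial>G))"

(* \<theta> is a value of the functional T_\<beta> at the distribution G. *)
definition dpd_minimizer ::
  "'x measure \<Rightarrow> (real^'p \<Rightarrow> 'x \<Rightarrow> real) \<Rightarrow> (real^'p) set \<Rightarrow> real \<Rightarrow> 'x measure \<Rightarrow> real^'p \<Rightarrow> bool" where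
  "dpd_minimizer \<mu> f \<Theta> \<beta> G \<theta> \<longleftrightarrow> is_arg_min (dpd_objective \<mu> f \<beta> G) (\<lambda>t. t \<in> \<Theta>) \<theta>"

(* Mass 1/n at each of the first n observations X 0 \<omega>, ..., X (n - 1) \<omega>; meaningful for n > 0. *)
definition empirical_measure ::
  "'x measure \<Rightarrow> (nat \<Rightarrow> 'w \<Rightarrow> 'x) \<Rightarrow> nat \<Rightarrow> 'w \<Rightarrow> 'x measure" where
  "empirical_measure S X n \<omega> = distr (uniform_count_measure {..<n}) S (\<lambda>i. X i \<omega>)"

definition weak_conv_bc :: "(nat \<Rightarrow> 'a::topological_space measure) \<Rightarrow> 'a measure \<Rightarrow> bool" where
  "weak_conv_bc \<nu>s \<nu> \<longleftrightarrow>
     (\<forall>h::'a \<Rightarrow> real. continuous_on UNIV h \<longrightarrow> bounded (range h) \<longrightarrow>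
        (\<lambda>n. \<integral>x. h x \<partial>\<nu>s n) \<longlonglongrightarrow> (\<integral>x. h x \<partial>\<nu>))"

(* \<nu> = N(a, S), with S symmetric positive semidefinite but possibly singular: the law of a + A z
   for z standard normal in R^p and A A^T = S. *)
definition multivariate_normal :: "(real^'p) measure \<Rightarrow> real^'p \<Rightarrow> real^'p^'p \<Rightarrow> bool" where
  "multivariate_normal \<nu> a S \<longleftrightarrow>
     (\<exists>A::real^'p^'p. A ** transpose A = S \<and>
        \<nu> = distr (\<Pi>\<^sub>M i\<in>(UNIV :: 'p set). std_normal_distribution) borel
              (\<lambda>z. a + A *v (\<chi> i. z i)))"

definition congr_by ::
  "(real^'p \<Rightarrow> real^'r) \<Rightarrow> (real^'p \<Rightarrow> real^'p^'p) \<Rightarrow> real^'p \<Rightarrow> real^'r^'r" where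
  "congr_by m S \<theta> = transpose (deriv_transp m \<theta>) ** S \<theta> ** deriv_transp m \<theta>"

definition wald_stat ::
  "'x measure \<Rightarrow> (real^'p \<Rightarrow> 'x \<Rightarrow> real) \<Rightarrow> real \<Rightarrow> (real^'p \<Rightarrow> real^'r) \<Rightarrow> nat \<Rightarrow> real^'p \<Rightarrow> real" where
  "wald_stat \<mu> f \<beta> m n \<theta> =
     real n * (m \<theta> \<bullet> (matrix_inv (congr_by m (Sigma_model \<mu> f \<beta>) \<theta>) *v m \<theta>))"

definition charpoly :: "real^'r^'r \<Rightarrow> real poly" where
  "charpoly A = det (\<chi> i j. if i = j then [:- (A $ i $ j), 1:] else [:- (A $ i $ j):])"

(* c lists all eigenvalues of A, repeated according to algebraic multiplicity. *)
definition lists_eigenvalues :: "real^'r^'r \<Rightarrow> ('r \<Rightarrow> real) \<Rightarrow> bool" where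
  "lists_eigenvalues A c \<longleftrightarrow> charpoly A = (\<Prod>i\<in>UNIV. [:- c i, 1:])"

lemma poly_charpoly: "poly (charpoly A) x = det (mat x - A)"
proof -
  have "poly (if i = j then [:- (A $ i $ j), 1:] else [:- (A $ i $ j):]) x = (mat x - A) $ i $ j"
    for i j by (simp add: mat_def)
  then show ?thesis
    unfolding charpoly_def det_def by (simp add: poly_sum poly_prod sign_def)
qed

lemma lists_eigenvalues_range:
  assumes "lists_eigenvalues A c"
  shows "range c = {x. \<exists>v. v \<noteq> 0 \<and> A *v v = x *\<^sub>R v}"
proof -
  have "x \<in> range c \<longleftrightarrow> (\<exists>v. v \<noteq> 0 \<and> A *v v = x *\<^sub>R v)" for x
  proof -
    have "x \<in> range c \<longleftrightarrow> det (mat x - A) = 0"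
      using assms by (auto simp: lists_eigenvalues_def poly_prod simp flip: poly_charpoly)
    also have "\<dots> \<longleftrightarrow> (\<exists>v. v \<noteq> 0 \<and> (mat x - A) *v v = 0)"
      by (metis invertible_det_nz invertible_left_inverse matrix_left_invertible_ker)
    also have "\<dots> \<longleftrightarrow> (\<exists>v. v \<noteq> 0 \<and> A *v v = x *\<^sub>R v)"
    proof -
      have "mat x *v v = x *\<^sub>R v" for v :: "real^'a"
        by (simp add: vec_eq_iff matrix_vector_mult_def mat_def if_distrib[of "\<lambda>y. y * _"] cong: if_cong)
      then show ?thesis by (simp add: matrix_vector_mult_diff_rdistrib) metis
    qed
    finally show ?thesis .
  qed
  then show ?thesis by auto
qed

end

theory Submission
  imports Defs
begin

text \<open>
Write \<open>M\<close> for \<open>deriv_transp m\<close>, \<open>T\<^sub>n = sqrt n (\<theta>h n - \<theta>\<^sub>0)\<close> and \<open>V = (M\<^sup>T \<Sigma>\<^sub>\<beta> M)\<^sup>-\<^sup>1\<close>.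
Since \<open>m \<theta>\<^sub>0 = 0\<close>, the vector \<open>sqrt n m(\<theta>h n)\<close> differs from \<open>M(\<theta>\<^sub>0)\<^sup>T T\<^sub>n\<close> by a term that, for large \<open>n\<close>, is small as long as
\<open>T\<^sub>n\<close> stays bounded, and \<open>V(\<theta>h n)\<close> is then close to \<open>V(\<theta>\<^sub>0)\<close>.  Hence the statistic is close to
\<open>h(T\<^sub>n)\<close> with the quadratic form \<open>h(t) = (M\<^sup>T t) \<bullet> V (M\<^sup>T t)\<close>, everything taken at \<open>\<theta>\<^sub>0\<close>
(\<open>quadratic_delta_method\<close>).  A weakly convergent sequence is tight, so closeness on bounded sets of values
of \<open>T\<^sub>n\<close> suffices for the statistic to converge in law to the image of the normal limit under \<open>h\<close>
(\<open>weak_conv_bc_imp_weak_conv_m\<close>).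

The normal limit is the law of \<open>B x\<close> with \<open>x\<close> standard normal in \<open>\<real>\<^sup>p\<close> and \<open>B B\<^sup>T = \<Sigma>\<^sub>\<beta>\<^sub>,\<^sub>g\<close>.  So
the limit law is that of \<open>(D x) \<bullet> V (D x)\<close> with \<open>D = M\<^sup>T B\<close>, and \<open>D D\<^sup>T\<close> is the second factor of the
matrix \<open>A = V D D\<^sup>T\<close> whose eigenvalues are asked for.  The matrix \<open>A\<close> need not be symmetric.  But one can write
\<open>D = E Q\<close>, where \<open>E\<close> is square and the rows of \<open>Q\<close> are orthonormal; then \<open>A = V E E\<^sup>T\<close> has the same
characteristic polynomial as the symmetric matrix \<open>E\<^sup>T V E\<close> (\<open>charpoly_mult_commute\<close>), and an orthonormal
eigenbasis of the latter turns the quadratic form into a sum of squares of orthonormal coordinates of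
\<open>x\<close>, weighted by the eigenvalues of \<open>A\<close> (\<open>quadratic_form_eigenvalues\<close>).

Finally, the standard normal law is invariant under rotations, so orthonormal coordinates of \<open>x\<close> are
independent standard normal variables (\<open>distr_weighted_squares\<close>).
\<close>

section \<open>Spectral theorem for symmetric matrices\<close>

text \<open>
The form \<open>x \<bullet> f x\<close> attains its maximum over the compact unit sphere of \<open>S\<close>.  At a maximiser \<open>v\<close> the
component \<open>w\<close> of \<open>f v\<close> orthogonal to \<open>v\<close> vanishes, since otherwise a small step from \<open>v\<close> in the direction
\<open>w\<close> would increase the Rayleigh quotient.
\<close>

lemma selfadjoint_max_eigenvector:
  fixes f :: "'a::euclidean_space \<Rightarrow> 'a"
  assumes f: "linear f" and sa: "\<And>x y. f x \<bullet> y = x \<bullet> f y"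
    and S: "subspace S" "\<And>x. x \<in> S \<Longrightarrow> f x \<in> S" "S \<noteq> {0}"
  shows "\<exists>v c. v \<in> S \<and> norm v = 1 \<and> f v = c *\<^sub>R v"
proof -
  let ?K = "S \<inter> sphere 0 1"
  obtain u where u: "u \<in> S" "u \<noteq> 0"
    using S(1,3) subspace_0 by blast
  then have "u /\<^sub>R norm u \<in> ?K"
    using S(1) by (simp add: subspace_scale)
  moreover have "compact ?K"
    using closed_subspace[OF S(1)] by (simp add: closed_Int_compact)
  moreover have "continuous_on ?K (\<lambda>x. x \<bullet> f x)"
    by (intro continuous_intros linear_continuous_on linear_conv_bounded_linear[THEN iffD1] f)
  ultimately obtain v where v: "v \<in> ?K" "\<And>x. x \<in> ?K \<Longrightarrow> x \<bullet> f x \<le> v \<bullet> f v"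
    using continuous_attains_sup[of ?K "\<lambda>x. x \<bullet> f x"] by blast
  define c where "c = v \<bullet> f v"
  have vv: "v \<in> S" "norm v = 1" "v \<bullet> v = 1"
    using v(1) by (auto simp: norm_eq_1)
  have bound: "x \<bullet> f x \<le> c * (x \<bullet> x)" if "x \<in> S" for x
  proof (cases "x = 0")
    case False
    then have "x /\<^sub>R norm x \<in> ?K" using S(1) that by (simp add: subspace_scale)
    from v(2)[OF this] have "(x \<bullet> f x) / (norm x)\<^sup>2 \<le> c"
      by (simp add: c_def linear_cmul[OF f] power2_eq_square field_simps)
    then show ?thesis using False by (simp add: field_simps power2_norm_eq_inner)
  qed (simp add: linear_0[OF f])
  define w where "w = f v - c *\<^sub>R v"
  have wS: "w \<in> S" unfolding w_def by (intro subspace_diff subspace_scale S vv)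
  have wv: "w \<bullet> v = 0" by (simp add: w_def inner_diff_left vv c_def inner_commute[of "f v" v])
  have fv: "f v = w + c *\<^sub>R v" by (simp add: w_def)
  have vfw: "v \<bullet> f w = w \<bullet> w" "w \<bullet> f v = w \<bullet> w"
    using wv by (simp_all add: sa[symmetric] fv inner_add inner_commute)
  define k where "k = c * (w \<bullet> w) - w \<bullet> f w"
  \<comment> \<open>Maximality of \<open>v\<close>, compared with \<open>v + t w\<close>: the left side is linear in \<open>t\<close>, the right side
    quadratic, so small \<open>t\<close> force the linear coefficient to vanish.\<close>
  have ineq: "2 * t * (w \<bullet> w) \<le> t\<^sup>2 * k" for t
  proof -
    have "v + t *\<^sub>R w \<in> S" by (intro subspace_add subspace_scale S vv wS)
    from bound[OF this] show ?thesis
      by (simp add: linear_add[OF f] linear_cmul[OF f] inner_add vfw wv inner_commute[of v w] vv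
          c_def[symmetric] k_def power2_eq_square algebra_simps)
  qed
  have "w \<bullet> w = 0"
  proof (rule ccontr)
    assume "w \<bullet> w \<noteq> 0"
    then have pos: "w \<bullet> w > 0" by simp
    define t where "t = (w \<bullet> w) / (\<bar>k\<bar> + 1)"
    have t: "t > 0" using pos by (simp add: t_def)
    have "t * k \<le> t * (\<bar>k\<bar> + 1)" using t by (intro mult_left_mono) auto
    also have "\<dots> = w \<bullet> w" by (simp add: t_def)
    finally have "t * (t * k) \<le> t * (w \<bullet> w)" using t by simp
    with ineq[of t] have "t * (w \<bullet> w) \<le> 0" by (simp add: power2_eq_square mult.assoc)
    with t have "w \<bullet> w \<le> 0" by (simp add: mult_le_0_iff)
    with pos show False by linarith
  qed
  then have "f v = c *\<^sub>R v" using fv by simp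
  with vv show ?thesis by blast
qed

text \<open>
The part of \<open>S\<close> orthogonal to one eigenvector is again invariant, so eigenvectors can be split off one
by one.
\<close>

lemma selfadjoint_eigenbasis_subspace:
  fixes f :: "'a::euclidean_space \<Rightarrow> 'a"
  assumes f: "linear f" and sa: "\<And>x y. f x \<bullet> y = x \<bullet> f y"
  shows "subspace S \<Longrightarrow> (\<And>x. x \<in> S \<Longrightarrow> f x \<in> S) \<Longrightarrow>
    \<exists>B \<subseteq> S. pairwise orthogonal B \<and> span B = S \<and> (\<forall>b\<in>B. norm b = 1 \<and> (\<exists>c. f b = c *\<^sub>R b))"
proof (induction "dim S" arbitrary: S rule: less_induct)
  case less
  show ?case
  proof (cases "S = {0}")
    case True
    then show ?thesis by (intro exI[of _ "{}"]) auto
  next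
    case False
    then obtain v c where v: "v \<in> S" "norm v = 1" "f v = c *\<^sub>R v"
      using selfadjoint_max_eigenvector[OF f sa less.prems] by blast
    define S' where "S' = {x \<in> S. v \<bullet> x = 0}"
    have S': "subspace S'"
      using less.prems(1) unfolding S'_def subspace_def by (auto simp: inner_add)
    have inv: "f x \<in> S'" if "x \<in> S'" for x
      using that less.prems(2) by (auto simp: S'_def sa[symmetric] v)
    have "v \<notin> S'" using v by (auto simp: S'_def)
    moreover have "S' \<subseteq> S" by (auto simp: S'_def)
    ultimately have "S' \<subset> S" using v by blast
    then have "dim S' < dim S"
      by (intro dim_psubset) (simp add: span_eq_iff[THEN iffD2, OF S'] span_eq_iff[THEN iffD2, OF less.prems(1)])
    have "\<exists>B\<subseteq>S'. pairwise orthogonal B \<and> span B = S' \<and> (\<forall>b\<in>B. norm b = 1 \<and> (\<exists>c. f b = c *\<^sub>R b))"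
      by (rule less.hyps) (fact, fact, rule inv)
    then obtain B where B: "B \<subseteq> S'" "pairwise orthogonal B" "span B = S'"
      "\<forall>b\<in>B. norm b = 1 \<and> (\<exists>c. f b = c *\<^sub>R b)" by (elim exE conjE) (rule that)
    have "pairwise orthogonal (insert v B)"
      using B(1,2) by (auto simp: pairwise_insert S'_def orthogonal_def inner_commute)
    moreover have "span (insert v B) = S"
    proof
      show "span (insert v B) \<subseteq> S"
        using v(1) B(1) less.prems(1) by (intro span_minimal) (auto simp: S'_def)
      show "S \<subseteq> span (insert v B)"
      proof
        fix x assume x: "x \<in> S"
        have "x - (v \<bullet> x) *\<^sub>R v \<in> S'"
          using x v(1,2) less.prems(1)
          by (simp add: S'_def subspace_diff subspace_scale inner_diff_right norm_eq_1)
        then show "x \<in> span (insert v B)"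
          unfolding span_breakdown_eq B(3) by blast
      qed
    qed
    moreover have "insert v B \<subseteq> S"
      using v(1) B(1) by (auto simp: S'_def)
    moreover have "\<forall>b\<in>insert v B. norm b = 1 \<and> (\<exists>c. f b = c *\<^sub>R b)"
      using v(2,3) B(4) by blast
    ultimately show ?thesis by (intro exI[of _ "insert v B"] conjI)
  qed
qed

abbreviation diag :: "('n::finite \<Rightarrow> real) \<Rightarrow> real^'n^'n" where
  "diag c \<equiv> (\<chi> i j. if i = j then c i else 0)"

lemma diag_mult_vec [simp]: "(diag c *v x) $ i = c i * x $ i"
  by (simp add: matrix_vector_mult_def if_distrib[of "\<lambda>y. y * _"] cong: if_cong)

lemma diag_mult_left: "(diag c ** A) $ i = c i *\<^sub>R (A $ i)"
  by (simp add: vec_eq_iff matrix_matrix_mult_def if_distrib[of "\<lambda>y. y * _"] cong: if_cong)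

lemma matrix_rows_inner:
  fixes A :: "real^'n^'m" and B :: "real^'n^'k"
  shows "(A ** transpose B) $ i $ j = (A $ i) \<bullet> (B $ j)"
  by (simp add: matrix_matrix_mult_def transpose_def inner_vec_def)

lemma matrix_rows_eq_of_inner:
  fixes A :: "real^'n^'m" and B :: "real^'n^'k" and C
  assumes "\<And>i j. A $ i \<bullet> B $ j = C $ i $ j"
  shows "A ** transpose B = C"
  using assms by (simp add: vec_eq_iff matrix_rows_inner)

text \<open>
The rows of \<open>R\<close> are an orthonormal eigenbasis, and \<open>R Q = diag c R\<close> says just that.
\<close>

theorem symmetric_matrix_diagonalisation:
  fixes Q :: "real^'n^'n"
  assumes Q: "transpose Q = Q"
  obtains R c where "orthogonal_matrix R" "Q = transpose R ** diag c ** R"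
proof -
  have sa: "(Q *v x) \<bullet> y = x \<bullet> (Q *v y)" for x y
    by (metis Q dot_lmul_matrix inner_commute transpose_matrix_vector)
  obtain B where B: "pairwise orthogonal B" "span B = UNIV"
      "\<forall>b\<in>B. norm b = 1 \<and> (\<exists>c. Q *v b = c *\<^sub>R b)"
    using selfadjoint_eigenbasis_subspace[of "(*v) Q" UNIV] sa by auto
  have "independent B"
    using B by (intro pairwise_orthogonal_independent) auto
  then have "finite B" and "dim B = card B"
    by (simp_all add: independent_imp_finite dim_eq_card_independent)
  moreover have "dim B = CARD('n)"
    using arg_cong[OF B(2), of dim] by simp
  ultimately have "card B = CARD('n)" "finite B" by simp_all
  then obtain b where b: "bij_betw b (UNIV::'n set) B"
    using finite_same_card_bij[of "UNIV :: 'n set" B] by auto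
  define R where "R = (\<chi> i. b i)"
  have bi: "b i \<in> B" for i using b by (auto simp: bij_betw_def)
  have binj: "b i = b j \<longleftrightarrow> i = j" for i j using b by (auto simp: bij_betw_def inj_on_def)
  have orth: "b i \<bullet> b j = (if i = j then 1 else 0)" for i j
    using B(1,3) bi binj by (auto simp: pairwise_def orthogonal_def norm_eq_1)
  have RRt: "R ** transpose R = mat 1"
    by (rule matrix_rows_eq_of_inner) (simp add: R_def orth mat_def)
  then have R: "orthogonal_matrix R"
    unfolding orthogonal_matrix using matrix_left_right_inverse by blast
  have "\<forall>i. \<exists>c. Q *v b i = c *\<^sub>R b i" using B(3) bi by blast
  then obtain c where c: "\<And>i. Q *v b i = c i *\<^sub>R b i" by metis
  have "R ** Q = diag c ** R"
  proof -
    have "(R ** transpose Q) $ i $ j = (diag c ** R) $ i $ j" for i j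
    proof -
      have "b i \<bullet> Q $ j = (Q *v b i) $ j" by (simp add: matrix_vector_mul_component inner_commute)
      then show ?thesis by (simp add: matrix_rows_inner diag_mult_left c) (simp add: R_def c)
    qed
    then show ?thesis by (simp add: vec_eq_iff Q)
  qed
  then have "Q = transpose R ** diag c ** R"
    using R matrix_mul_assoc[of "transpose R" R Q] matrix_mul_assoc[of "transpose R" "diag c" R]
    by (simp add: orthogonal_matrix_def)
  with R show ?thesis using that by blast
qed

section \<open>Characteristic polynomials\<close>

lemma charpoly_eqI:
  assumes "\<And>x. det (mat x - A) = poly p x"
  shows "charpoly A = p"
  using assms by (simp add: poly_eq_poly_eq_iff[symmetric] fun_eq_iff poly_charpoly)

lemma mat_mult_left [simp]: "mat x ** A = x *\<^sub>R A" for A :: "real^'n^'m"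
  by (simp add: vec_eq_iff matrix_matrix_mult_def mat_def if_distrib[of "\<lambda>y. y * _"] cong: if_cong)

lemma mat_mult_right [simp]: "A ** mat x = x *\<^sub>R A" for A :: "real^'n^'m"
  by (simp add: vec_eq_iff matrix_matrix_mult_def mat_def if_distrib[of "\<lambda>y. _ * y"] mult.commute cong: if_cong)

lemma bounded_bilinear_matrix_mult:
  "bounded_bilinear ((**) :: real^'n^'m \<Rightarrow> real^'k^'n \<Rightarrow> real^'k^'m)"
  unfolding bilinear_conv_bounded_bilinear[symmetric] bilinear_def
  by (auto intro!: linearI simp: vec_eq_iff matrix_matrix_mult_def algebra_simps sum.distrib
      sum_distrib_left)

lemmas tendsto_matrix_mult [tendsto_intros] = bounded_bilinear.tendsto[OF bounded_bilinear_matrix_mult]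

lemma tendsto_det:
  fixes A :: "'a \<Rightarrow> real^'n^'n"
  assumes "(A \<longlongrightarrow> L) F"
  shows "((\<lambda>x. det (A x)) \<longlongrightarrow> det L) F"
  unfolding det_def by (intro tendsto_intros assms)

text \<open>
The exceptional \<open>e\<close> are the roots of \<open>charpoly (- X)\<close>.  This polynomial is not zero: if \<open>e\<close> exceeds a
bound for the operator norm of \<open>X\<close>, then \<open>X v = - e v\<close> is impossible for \<open>v \<noteq> 0\<close>.
\<close>

lemma matrix_add_scalar_invertible:
  fixes X :: "real^'n^'n"
  shows "eventually (\<lambda>e. invertible (X + mat e)) (at 0)"
proof -
  have p: "poly (charpoly (- X)) e = det (X + mat e)" for e
    by (simp add: poly_charpoly add.commute)
  have "charpoly (- X) \<noteq> 0"
  proof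
    assume 0: "charpoly (- X) = 0"
    obtain K where K: "\<And>x. norm (X *v x) \<le> norm x * K" "K > 0"
      using bounded_linear.pos_bounded[OF matrix_vector_mul_bounded_linear[of X]] by blast
    from 0 p[of "K + 1"] have "\<not> invertible (X + mat (K + 1))"
      by (simp add: invertible_det_nz)
    then obtain v where v: "v \<noteq> 0" "(X + mat (K + 1)) *v v = 0"
      by (metis invertible_left_inverse matrix_left_invertible_ker)
    have "mat (K + 1) *v v = (K + 1) *\<^sub>R v"
      by (simp add: vec_eq_iff matrix_vector_mult_def mat_def if_distrib[of "\<lambda>y. y * _"] cong: if_cong)
    with v(2) have "X *v v = - ((K + 1) *\<^sub>R v)"
      by (simp add: matrix_vector_mult_add_rdistrib add_eq_0_iff2)
    then have "norm (X *v v) = (K + 1) * norm v" using K(2) by simp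
    with K(1)[of v] v(1) show False by (simp add: algebra_simps)
  qed
  then have "finite {e. poly (charpoly (- X)) e = 0}" by (rule poly_roots_finite)
  then have "eventually (\<lambda>e. e \<notin> {e. poly (charpoly (- X)) e = 0}) (at 0)"
    unfolding eventually_at_topological
    by (intro exI[of _ "- ({e. poly (charpoly (- X)) e = 0} - {0})"]) (auto simp del: Compl_Diff_eq intro!: finite_imp_closed)
  then show ?thesis by (simp add: p invertible_det_nz)
qed

text \<open>
If \<open>X\<close> is invertible, conjugation by \<open>X\<close> takes \<open>Y ** X\<close> to \<open>X ** Y\<close>.  A singular \<open>X\<close> is a limit of the
invertible matrices \<open>X + mat e\<close>, and determinants are continuous.
\<close>

theorem charpoly_mult_commute:
  fixes X Y :: "real^'n^'n"
  shows "charpoly (X ** Y) = charpoly (Y ** X)"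
proof (rule charpoly_eqI)
  fix x :: real
  have inv: "det (mat x - Z ** Y) = det (mat x - Y ** Z)" if "invertible Z" for Z
  proof -
    have "(mat x - Z ** Y) ** Z = Z ** (mat x - Y ** Z)"
      by (simp add: bounded_bilinear.diff_left[OF bounded_bilinear_matrix_mult]
          bounded_bilinear.diff_right[OF bounded_bilinear_matrix_mult] matrix_mul_assoc)
    from arg_cong[OF this, of det]
    have "det (mat x - Z ** Y) * det Z = det Z * det (mat x - Y ** Z)"
      by (simp add: det_mul)
    with that show ?thesis by (simp add: invertible_det_nz)
  qed
  have lim: "((\<lambda>e. X + mat e) \<longlongrightarrow> X + mat 0) (at (0::real))"
  proof -
    have m: "mat e = e *\<^sub>R (mat 1 :: real^'n^'n)" for e
      by (simp add: mat_def vec_eq_iff)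
    have "((\<lambda>e. X + e *\<^sub>R mat 1) \<longlongrightarrow> X + 0 *\<^sub>R mat 1) (at (0::real))"
      by (intro tendsto_intros)
    then show ?thesis by (simp only: m[symmetric])
  qed
  have lim1: "((\<lambda>e. det (mat x - (X + mat e) ** Y)) \<longlongrightarrow> det (mat x - (X + mat 0) ** Y)) (at (0::real))"
    and lim2: "((\<lambda>e. det (mat x - Y ** (X + mat e))) \<longlongrightarrow> det (mat x - Y ** (X + mat 0))) (at (0::real))"
    by (rule tendsto_det[OF tendsto_diff[OF tendsto_const tendsto_matrix_mult[OF lim tendsto_const]]],
        rule tendsto_det[OF tendsto_diff[OF tendsto_const tendsto_matrix_mult[OF tendsto_const lim]]])
  have "((\<lambda>e. det (mat x - (X + mat e) ** Y)) \<longlongrightarrow> det (mat x - Y ** (X + mat 0))) (at (0::real))"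
    by (rule Lim_transform_eventually[OF lim2])
      (use matrix_add_scalar_invertible[of X] in eventually_elim, simp add: inv)
  from tendsto_unique[OF _ lim1 this]
  have "det (mat x - X ** Y) = det (mat x - Y ** X)" by simp
  then show "det (mat x - X ** Y) = poly (charpoly (Y ** X)) x"
    by (simp add: poly_charpoly)
qed

lemma lists_eigenvalues_orthogonal_diag:
  assumes R: "orthogonal_matrix (R :: real^'n^'n)"
  shows "lists_eigenvalues (transpose R ** diag c ** R) c"
  unfolding lists_eigenvalues_def
proof -
  have "charpoly (transpose R ** diag c ** R) = charpoly (R ** (transpose R ** diag c))"
    by (rule charpoly_mult_commute)
  also have "\<dots> = charpoly (diag c)"
    using R by (simp add: matrix_mul_assoc orthogonal_matrix_def)
  also have "\<dots> = (\<Prod>i\<in>UNIV. [:- c i, 1:])"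
  proof (rule charpoly_eqI)
    fix x
    have "det (mat x - diag c) = (\<Prod>i\<in>UNIV. (mat x - diag c) $ i $ i)"
      by (rule det_diagonal) (simp add: mat_def)
    then show "det (mat x - diag c) = poly (\<Prod>i\<in>UNIV. [:- c i, 1:]) x"
      by (simp add: mat_def poly_prod)
  qed
  finally show "charpoly (transpose R ** diag c ** R) = (\<Prod>i\<in>UNIV. [:- c i, 1:])" .
qed

text \<open>
Both families enumerate the roots of one polynomial with multiplicity, so they are equal as
multisets.
\<close>

lemma lists_eigenvalues_unique:
  fixes c d :: "'n::finite \<Rightarrow> real"
  assumes "lists_eigenvalues A c" "lists_eigenvalues A d"
  obtains p where "bij p" "\<And>i. c i = d (p i)"
proof -
  have "image_mset c (mset_set UNIV) = proots (\<Prod>i\<in>UNIV. [:- c i, 1:])" for c :: "'n \<Rightarrow> real"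
  proof (subst proots_prod)
    have "(\<Sum>i\<in>A. {#c i#}) = image_mset c (mset_set A)" if "finite A" for A
      using that by (induction A) auto
    then show "image_mset c (mset_set UNIV) = (\<Sum>i\<in>UNIV. proots [:- c i, 1:])" by simp
  qed simp
  moreover have "(\<Prod>i\<in>UNIV. [:- c i, 1:]) = (\<Prod>i\<in>UNIV. [:- d i, 1:])"
    using assms unfolding lists_eigenvalues_def by (rule trans[OF sym])
  ultimately have "image_mset c (mset_set UNIV) = image_mset d (mset_set UNIV)" by simp
  from image_mset_eq_implies_permutes[OF finite_class.finite_UNIV this]
  obtain p where "p permutes UNIV" "\<forall>x\<in>UNIV. c x = d (p x)" by blast
  then show ?thesis
    by (intro that[of p]) (auto dest: permutes_bij)
qed

section \<open>Quadratic forms in orthonormal coordinates\<close>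

text \<open>
The vectors \<open>w i\<close> extend to an orthogonal basis of the whole space.  Its \<open>DIM('a) - card I\<close> further
members are enough to serve the indices in \<open>J - I\<close>.
\<close>

lemma orthonormal_family_extend:
  fixes w :: "'i \<Rightarrow> 'a::euclidean_space"
  assumes J: "finite J" "I \<subseteq> J" "card J \<le> DIM('a)"
    and w: "\<And>i j. i \<in> I \<Longrightarrow> j \<in> I \<Longrightarrow> w i \<bullet> w j = (if i = j then 1 else 0)"
  obtains v where "\<And>i. i \<in> I \<Longrightarrow> v i = w i"
    and "\<And>i j. i \<in> J \<Longrightarrow> j \<in> J \<Longrightarrow> v i \<bullet> v j = (if i = j then 1 else 0)"
proof -
  let ?B = "w ` I"
  have inj: "inj_on w I"
  proof (rule inj_onI)
    fix i j assume "i \<in> I" "j \<in> I" "w i = w j"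
    then show "i = j" using w[of i j] w[of i i] by (auto split: if_splits)
  qed
  have "pairwise orthogonal ?B"
    unfolding pairwise_image by (auto simp: pairwise_def orthogonal_def w)
  from orthogonal_extension_strong[OF this, of UNIV]
  obtain U where U: "U \<inter> insert 0 ?B = {}" "pairwise orthogonal (?B \<union> U)"
    "span (?B \<union> U) = span (?B \<union> UNIV)" .
  have "w i \<noteq> 0" if "i \<in> I" for i using w[OF that that] by auto
  then have "0 \<notin> ?B" by auto
  then have ind: "independent (?B \<union> U)"
    using U by (intro pairwise_orthogonal_independent) auto
  have "dim (?B \<union> U) = DIM('a)"
    using arg_cong[OF U(3), of dim] by simp
  then have cBU: "card (?B \<union> U) = DIM('a)" and fin: "finite (?B \<union> U)"
    using ind independent_imp_finite[OF ind] by (simp_all add: dim_eq_card_independent)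
  have fI: "finite I" using J(1,2) by (rule rev_finite_subset)
  have "card (?B \<union> U) = card I + card U"
    using fin U(1) by (subst card_Un_disjoint) (auto simp: card_image inj)
  then have "card (J - I) \<le> card U"
    using cBU J fI by (simp add: card_Diff_subset)
  moreover have "finite (J - I)" "finite U" using J(1) fin by simp_all
  ultimately obtain h where h: "inj_on h (J - I)" "h ` (J - I) \<subseteq> U"
    using card_le_inj[of "J - I" U] by blast
  define v where "v i = (if i \<in> I then w i else sgn (h i))" for i
  have mem: "h i \<in> U" if "i \<in> J - I" for i using h(2) imageI[OF that, of h] by (rule subsetD)
  have orth: "x \<bullet> y = 0" if "x \<in> ?B \<union> U" "y \<in> ?B \<union> U" "x \<noteq> y" for x y
    by (rule U(2)[unfolded pairwise_def orthogonal_def, rule_format]) (fact that)+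
  have wh: "w i \<bullet> h j = 0" if "i \<in> I" "j \<in> J - I" for i j
  proof (rule orth)
    show "w i \<in> ?B \<union> U" "h j \<in> ?B \<union> U" using that(1) mem[OF that(2)] by simp_all
    show "w i \<noteq> h j"
    proof
      assume "w i = h j"
      then have "h j \<in> U \<inter> insert 0 ?B" using that(1) mem[OF that(2)] by (metis IntI imageI insertCI)
      then show False using U(1) by simp
    qed
  qed
  have hh: "sgn (h i) \<bullet> sgn (h j) = (if i = j then 1 else 0)" if "i \<in> J - I" "j \<in> J - I" for i j
  proof (cases "i = j")
    case True
    have "h i \<noteq> 0" using mem[OF that(1)] U(1) by auto
    then have "norm (sgn (h i)) = 1" by (simp add: norm_sgn)
    with True show ?thesis by (simp add: norm_eq_1)
  next
    case False
    then have "h i \<noteq> h j" using inj_onD[OF h(1) _ that] by blast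
    then have "h i \<bullet> h j = 0" using mem[OF that(1)] mem[OF that(2)] by (intro orth UnI2)
    with False show ?thesis by (simp add: sgn_div_norm)
  qed
  have "v i \<bullet> v j = (if i = j then 1 else 0)" if ij: "i \<in> J" "j \<in> J" for i j
  proof (cases "i \<in> I"; cases "j \<in> I")
    assume "i \<in> I" "j \<in> I"
    then show ?thesis by (simp add: v_def w)
  next
    assume "i \<in> I" "j \<notin> I"
    then show ?thesis using wh[of i j] ij by (auto simp: v_def sgn_div_norm)
  next
    assume "i \<notin> I" "j \<in> I"
    then show ?thesis using wh[of j i] ij by (auto simp: v_def sgn_div_norm inner_commute)
  next
    assume "i \<notin> I" "j \<notin> I"
    then show ?thesis using hh[of i j] ij by (simp add: v_def)
  qed
  moreover have "v i = w i" if "i \<in> I" for i using that by (simp add: v_def)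
  ultimately show ?thesis using that by metis
qed

text \<open>
A nonzero row of \<open>D\<close> determines the corresponding row of \<open>V\<close> by normalisation.  A zero row leaves it free,
and the free rows are chosen by extending the orthonormal family, for which there is room because
\<open>D\<close> has no more rows than columns.
\<close>

lemma orthogonal_rows_factor:
  fixes D :: "real^'p^'r"
  assumes D: "D ** transpose D = diag d" and card: "CARD('r) \<le> CARD('p)"
  obtains V :: "real^'p^'r" where "V ** transpose V = mat 1" "D = diag (\<lambda>i. sqrt (d i)) ** V"
proof -
  have dot: "D $ i \<bullet> D $ j = (if i = j then d i else 0)" for i j
    using arg_cong[OF D, of "\<lambda>M. M $ i $ j"] by (simp add: matrix_rows_inner)
  have d: "norm (D $ i) = sqrt (d i)" for i using dot[of i i] by (simp add: norm_eq_sqrt_inner)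
  let ?I = "{i. D $ i \<noteq> 0}"
  obtain v where v: "\<And>i. i \<in> ?I \<Longrightarrow> v i = sgn (D $ i)"
    "\<And>i j. v i \<bullet> v j = (if i = j then 1 else 0)"
  proof (rule orthonormal_family_extend[of UNIV ?I "\<lambda>i. sgn (D $ i)"])
    show "sgn (D $ i) \<bullet> sgn (D $ j) = (if i = j then 1 else 0)" if "i \<in> ?I" "j \<in> ?I" for i j
    proof (cases "i = j")
      case True
      have "norm (sgn (D $ i)) = 1" using that by (simp add: norm_sgn)
      with True show ?thesis by (simp add: norm_eq_1)
    qed (simp add: sgn_div_norm dot)
  qed (use card in auto)
  define V where "V = (\<chi> i. v i)"
  have "V ** transpose V = mat 1"
    by (rule matrix_rows_eq_of_inner) (simp add: V_def v(2) mat_def)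
  moreover have "D $ i = sqrt (d i) *\<^sub>R v i" for i
    using v(1)[of i] by (cases "D $ i = 0") (auto simp: d[symmetric] sgn_div_norm)
  then have "D = diag (\<lambda>i. sqrt (d i)) ** V"
    by (simp add: vec_eq_iff[of D] diag_mult_left) (simp add: V_def)
  ultimately show ?thesis using that by blast
qed

lemma diag_quadratic_form: "y \<bullet> (diag c *v y) = (\<Sum>i\<in>UNIV. c i * (y $ i)\<^sup>2)"
  by (simp add: inner_vec_def power2_eq_square mult.left_commute)

lemma inner_matrix_vector:
  fixes A :: "real^'n^'m"
  shows "x \<bullet> (A *v y) = (transpose A *v x) \<bullet> y"
  by (simp add: dot_lmul_matrix transpose_matrix_vector)

text \<open>
Diagonalising \<open>D ** transpose D\<close> makes the rows of \<open>R1 ** D\<close> orthogonal, which gives \<open>D = E ** V1\<close> with \<open>E\<close>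
square and the rows of \<open>V1\<close> orthonormal.  Then \<open>D ** transpose D = E ** transpose E\<close>, and cyclic
commutation of the factors relates \<open>B ** (E ** transpose E)\<close> to the symmetric matrix
\<open>transpose E ** B ** E\<close>, which is also the matrix of the quadratic form in the coordinates
\<open>y = V1 *v z\<close>.
\<close>

lemma quadratic_form_diagonalisation:
  fixes D :: "real^'p^'r" and B :: "real^'r^'r"
  assumes B: "transpose B = B" and card: "CARD('r) \<le> CARD('p)"
  obtains V :: "real^'p^'r" and c where "V ** transpose V = mat 1"
    "lists_eigenvalues (B ** (D ** transpose D)) c"
    "\<And>z. (D *v z) \<bullet> (B *v (D *v z)) = (\<Sum>i\<in>UNIV. c i * ((V *v z) $ i)\<^sup>2)"
proof -
  obtain R1 d where R1: "orthogonal_matrix R1" "D ** transpose D = transpose R1 ** diag d ** R1"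
    by (rule symmetric_matrix_diagonalisation[of "D ** transpose D"])
      (simp add: matrix_transpose_mul)
  have R1': "R1 ** transpose R1 = mat 1" "transpose R1 ** R1 = mat 1"
    using R1(1) by (auto simp: orthogonal_matrix_def)
  have "(R1 ** D) ** transpose (R1 ** D) = R1 ** (D ** transpose D) ** transpose R1"
    by (simp add: matrix_transpose_mul matrix_mul_assoc)
  also have "\<dots> = (R1 ** transpose R1) ** diag d ** (R1 ** transpose R1)"
    by (simp add: R1(2) matrix_mul_assoc)
  also have "\<dots> = diag d" by (simp add: R1')
  finally obtain V1 :: "real^'p^'r" where V1: "V1 ** transpose V1 = mat 1"
    "R1 ** D = diag (\<lambda>i. sqrt (d i)) ** V1"
    using orthogonal_rows_factor[OF _ card] by blast
  define E where "E = transpose R1 ** diag (\<lambda>i. sqrt (d i))"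
  have "transpose R1 ** (R1 ** D) = E ** V1"
    by (simp add: V1 E_def matrix_mul_assoc)
  then have D: "D = E ** V1" by (simp add: matrix_mul_assoc R1')
  have "D ** transpose D = E ** (V1 ** transpose V1) ** transpose E"
    by (simp add: D matrix_transpose_mul matrix_mul_assoc)
  then have DD: "D ** transpose D = E ** transpose E" by (simp add: V1)
  obtain R c where R: "orthogonal_matrix R" "transpose E ** B ** E = transpose R ** diag c ** R"
    by (rule symmetric_matrix_diagonalisation[of "transpose E ** B ** E"])
      (simp add: matrix_transpose_mul matrix_mul_assoc B)
  have "charpoly (B ** (D ** transpose D)) = charpoly (transpose E ** (B ** E))"
    unfolding DD matrix_mul_assoc[of B] by (rule charpoly_mult_commute)
  then have "lists_eigenvalues (B ** (D ** transpose D)) c"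
    using lists_eigenvalues_orthogonal_diag[OF R(1), of c] R(2)
    by (simp add: lists_eigenvalues_def matrix_mul_assoc)
  moreover define V where "V = R ** V1"
  have "V ** transpose V = R ** (V1 ** transpose V1) ** transpose R"
    by (simp add: V_def matrix_transpose_mul matrix_mul_assoc)
  then have "V ** transpose V = mat 1"
    using R(1) V1 by (simp add: orthogonal_matrix_def)
  moreover have "(D *v z) \<bullet> (B *v (D *v z)) = (\<Sum>i\<in>UNIV. c i * ((V *v z) $ i)\<^sup>2)" for z
  proof -
    define y where "y = V1 *v z"
    have "(D *v z) \<bullet> (B *v (D *v z)) = (E *v y) \<bullet> (B *v (E *v y))"
      by (simp add: D y_def matrix_vector_mul_assoc)
    also have "\<dots> = y \<bullet> ((transpose E ** B ** E) *v y)"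
      using inner_matrix_vector[of y "transpose E" "B *v (E *v y)"]
      by (simp add: matrix_vector_mul_assoc matrix_mul_assoc del: transpose_matrix_vector)
    also have "\<dots> = (R *v y) \<bullet> (diag c *v (R *v y))"
      using inner_matrix_vector[of y "transpose R" "diag c *v (R *v y)"]
      by (simp add: R(2) matrix_vector_mul_assoc matrix_mul_assoc del: transpose_matrix_vector)
    also have "\<dots> = (\<Sum>i\<in>UNIV. c i * ((V *v z) $ i)\<^sup>2)"
      by (simp add: diag_quadratic_form V_def y_def matrix_vector_mul_assoc[symmetric])
    finally show ?thesis .
  qed
  ultimately show ?thesis using that by blast
qed

text \<open>
Any other enumeration of the eigenvalues is a permutation of the one constructed above; the rows of
\<open>V\<close> are permuted along with it.
\<close>

corollary quadratic_form_eigenvalues: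
  fixes D :: "real^'p^'r" and B :: "real^'r^'r"
  assumes B: "transpose B = B" and card: "CARD('r) \<le> CARD('p)"
    and c: "lists_eigenvalues (B ** (D ** transpose D)) c"
  obtains V :: "real^'p^'r" where "V ** transpose V = mat 1"
    "\<And>z. (D *v z) \<bullet> (B *v (D *v z)) = (\<Sum>i\<in>UNIV. c i * ((V *v z) $ i)\<^sup>2)"
proof -
  obtain V :: "real^'p^'r" and d where V: "V ** transpose V = mat 1"
    and d: "lists_eigenvalues (B ** (D ** transpose D)) d"
    and q: "\<And>z. (D *v z) \<bullet> (B *v (D *v z)) = (\<Sum>i\<in>UNIV. d i * ((V *v z) $ i)\<^sup>2)"
    by (rule quadratic_form_diagonalisation[OF B card, of D], rule that)
  obtain p where p: "bij p" "\<And>i. c i = d (p i)"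
    by (rule lists_eigenvalues_unique[OF c d], rule that)
  define W where "W = (\<chi> i. V $ p i)"
  have "V $ i \<bullet> V $ j = (if i = j then 1 else 0)" for i j
    using arg_cong[OF V, of "\<lambda>M. M $ i $ j"] by (simp add: matrix_rows_inner mat_def)
  then have "W ** transpose W = mat 1"
    using p(1) by (intro matrix_rows_eq_of_inner) (auto simp: W_def mat_def bij_def inj_def)
  moreover have "(\<Sum>i\<in>UNIV. d i * ((V *v z) $ i)\<^sup>2) = (\<Sum>i\<in>UNIV. c i * ((W *v z) $ i)\<^sup>2)" for z
    using p by (subst sum.reindex_bij_betw[OF p(1), symmetric])
      (simp add: W_def matrix_vector_mult_def)
  ultimately show ?thesis using that q by simp
qed

section \<open>Rotation invariance of the standard normal law\<close>

text \<open>
The argument for uniqueness of translation-invariant measures.  Let \<open>b\<close> be the indicator of the unit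
ball, which is invariant under \<open>R\<close> and under reflection.  Evaluate the double integral of
\<open>f (R y + x) * b (R y)\<close> in both orders: integrating over \<open>x\<close> first gives the integral of \<open>f\<close>, and
translating \<open>y\<close> by the preimage of \<open>x\<close> first gives the integral of \<open>f \<circ> R\<close>, both multiplied by the
volume of the ball, which is positive and finite.
\<close>

theorem nn_integral_lborel_orthogonal:
  fixes R :: "'a::euclidean_space \<Rightarrow> 'a"
  assumes R: "orthogonal_transformation R" and f[measurable]: "f \<in> borel_measurable borel"
  shows "(\<integral>\<^sup>+x. f (R x) \<partial>lborel) = (\<integral>\<^sup>+x. f x \<partial>lborel)"
proof -
  have lin: "linear R" using R by (rule orthogonal_transformation_linear)
  have [measurable]: "R \<in> borel_measurable borel"
    using lin by (intro borel_measurable_continuous_onI linear_continuous_on)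
      (simp add: linear_conv_bounded_linear)
  have trans: "(\<integral>\<^sup>+x. h (a + x) \<partial>lborel) = (\<integral>\<^sup>+x. h x \<partial>lborel)"
    if [measurable]: "h \<in> borel_measurable borel" for h :: "'a \<Rightarrow> ennreal" and a
    using nn_integral_distr[of "(+) a" lborel borel h] by (simp add: lborel_distr_plus)
  define b :: "'a \<Rightarrow> ennreal" where "b = indicator (ball 0 1)"
  have [measurable]: "b \<in> borel_measurable borel" by (simp add: b_def borel_measurable_indicator)
  have bR: "b (R y) = b y" and bm: "b (- y) = b y" for y
    using R by (auto simp: b_def indicator_def orthogonal_transformation_norm)
  have add: "R (x + y) = R x + R y" for x y using lin by (rule linear_add)
  obtain S where S: "R (S x) = x" for x
    using orthogonal_transformation_surj[OF R] by (metis surj_def)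
  have "(\<integral>\<^sup>+x. f x \<partial>lborel) * (\<integral>\<^sup>+y. b y \<partial>lborel)
      = (\<integral>\<^sup>+y. (\<integral>\<^sup>+x. f (R y + x) * b (R y) \<partial>lborel) \<partial>lborel)"
    by (simp add: bR nn_integral_multc nn_integral_cmult trans)
  also have "\<dots> = (\<integral>\<^sup>+x. (\<integral>\<^sup>+y. f (R y + x) * b (R y) \<partial>lborel) \<partial>lborel)"
    by (rule lborel_pair.Fubini') measurable
  also have "\<dots> = (\<integral>\<^sup>+x. (\<integral>\<^sup>+y. f (R y) * b (R y - x) \<partial>lborel) \<partial>lborel)"
  proof (rule nn_integral_cong)
    fix x
    have "(\<integral>\<^sup>+y. f (R (S x + y)) * b (R (S x + y) - x) \<partial>lborel)
        = (\<integral>\<^sup>+y. f (R y) * b (R y - x) \<partial>lborel)"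
      by (rule trans[of "\<lambda>y. f (R y) * b (R y - x)"]) measurable
    then show "(\<integral>\<^sup>+y. f (R y + x) * b (R y) \<partial>lborel) = (\<integral>\<^sup>+y. f (R y) * b (R y - x) \<partial>lborel)"
      by (simp add: add S add.commute)
  qed
  also have "\<dots> = (\<integral>\<^sup>+y. (\<integral>\<^sup>+x. f (R y) * b (R y - x) \<partial>lborel) \<partial>lborel)"
    by (rule lborel_pair.Fubini') measurable
  also have "\<dots> = (\<integral>\<^sup>+y. f (R y) * (\<integral>\<^sup>+x. b x \<partial>lborel) \<partial>lborel)"
  proof (rule nn_integral_cong)
    fix y
    have "b (R y - x) = b (- R y + x)" for x using bm[of "R y - x"] by (simp add: algebra_simps)
    then show "(\<integral>\<^sup>+x. f (R y) * b (R y - x) \<partial>lborel) = f (R y) * (\<integral>\<^sup>+x. b x \<partial>lborel)"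
      using trans[of b "- R y"] by (simp add: nn_integral_cmult)
  qed
  also have "\<dots> = (\<integral>\<^sup>+y. f (R y) \<partial>lborel) * (\<integral>\<^sup>+y. b y \<partial>lborel)"
    by (rule nn_integral_multc) measurable
  finally have eq: "(\<integral>\<^sup>+x. f x \<partial>lborel) * (\<integral>\<^sup>+y. b y \<partial>lborel)
    = (\<integral>\<^sup>+y. f (R y) \<partial>lborel) * (\<integral>\<^sup>+y. b y \<partial>lborel)" .
  have int: "(\<integral>\<^sup>+y. b y \<partial>lborel) = emeasure lborel (ball 0 1 :: 'a set)"
    by (simp add: b_def)
  have "emeasure lborel (ball 0 1 :: 'a set) \<noteq> 0"
    using open_not_negligible[of "ball 0 1 :: 'a set"] null_sets_completion_iff[of "ball 0 1 :: 'a set" lborel]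
    by (auto simp: negligible_iff_null_sets null_sets_def)
  moreover have "emeasure lborel (ball 0 1 :: 'a set) \<noteq> \<infinity>"
    using emeasure_bounded_finite[of "ball 0 1 :: 'a set"] by simp
  ultimately show ?thesis
    using eq unfolding int mult.commute[of _ "emeasure _ _"] by (simp add: ennreal_mult_cancel_left)
qed

definition std_normal_vec :: "(real^'n) measure" where
  "std_normal_vec = distr (\<Pi>\<^sub>M i\<in>UNIV. std_normal_distribution) borel (\<lambda>z. \<chi> i. z i)"

lemma measurable_vec_lambda [measurable (raw)]:
  fixes f :: "'n::finite \<Rightarrow> 'a \<Rightarrow> real"
  assumes "\<And>i. f i \<in> borel_measurable M"
  shows "(\<lambda>x. \<chi> i. f i x) \<in> borel_measurable M"
  using assms by (subst borel_measurable_euclidean_space) (auto simp: Basis_vec_def inner_axis)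

lemma measurable_vec_nth_real [measurable]: "(\<lambda>x::real^'n. x $ i) \<in> borel_measurable borel"
  by (intro borel_measurable_continuous_onI continuous_intros)

text \<open>
By definition \<open>lborel\<close> is a product over \<open>Basis\<close>; indexing by the coordinates instead makes the product match
the one in \<open>std_normal_vec\<close>.
\<close>

lemma lborel_vec: "(lborel :: (real^'n) measure) = distr (\<Pi>\<^sub>M i\<in>UNIV. lborel) borel (\<lambda>z. \<chi> i. z i)"
proof (rule lborel_eqI)
  interpret product_sigma_finite "\<lambda>_. lborel :: real measure" ..
  let ?T = "\<lambda>z. \<chi> i. z i :: real^'n"
  fix l u :: "real^'n" assume lu: "\<And>b. b \<in> Basis \<Longrightarrow> l \<bullet> b \<le> u \<bullet> b"
  have le: "l $ i \<le> u $ i" for i using lu[of "axis i 1"] by (auto simp: Basis_vec_def inner_axis)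
  have [measurable]: "?T \<in> borel_measurable (\<Pi>\<^sub>M i\<in>UNIV. lborel)" by measurable
  have "emeasure (distr (\<Pi>\<^sub>M i\<in>UNIV. lborel) borel ?T) (box l u)
      = emeasure (\<Pi>\<^sub>M i\<in>UNIV. lborel) (?T -` box l u \<inter> space (\<Pi>\<^sub>M i\<in>UNIV. lborel))"
    by (rule emeasure_distr) simp_all
  also have "?T -` box l u \<inter> space (\<Pi>\<^sub>M i\<in>UNIV. lborel) = (\<Pi>\<^sub>E i\<in>UNIV. {l $ i <..< u $ i})"
    by (auto simp: space_PiM mem_box_cart PiE_iff Pi_iff)
  also have "emeasure (\<Pi>\<^sub>M i\<in>UNIV. lborel) \<dots> = (\<Prod>i\<in>UNIV. emeasure lborel {l $ i <..< u $ i})"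
    by (rule emeasure_PiM) auto
  also have "\<dots> = ennreal (\<Prod>i\<in>UNIV. u $ i - l $ i)"
    by (simp add: le prod_ennreal)
  also have "(\<Prod>i\<in>UNIV. u $ i - l $ i) = (\<Prod>b\<in>Basis. (u - l) \<bullet> b)"
  proof -
    have B: "(Basis :: (real^'n) set) = range (\<lambda>i. axis i 1)" by (auto simp: Basis_vec_def)
    show ?thesis unfolding B
      by (subst prod.reindex) (auto simp: inj_on_def axis_eq_axis inner_axis)
  qed
  finally show "emeasure (distr (\<Pi>\<^sub>M i\<in>UNIV. lborel) borel ?T) (box l u) = (\<Prod>b\<in>Basis. (u - l) \<bullet> b)" .
qed simp

text \<open>
The density is written through \<open>x \<bullet> x\<close>, which exhibits its rotation invariance.
\<close>

lemma std_normal_vec_density: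
  "std_normal_vec = density lborel (\<lambda>x::real^'n. ennreal ((1 / sqrt (2 * pi)) ^ CARD('n) * exp (- (x \<bullet> x) / 2)))"
proof -
  interpret product_sigma_finite "\<lambda>_::'n. lborel :: real measure" ..
  interpret N: product_sigma_finite "\<lambda>_::'n. std_normal_distribution"
    by (simp add: product_sigma_finite_def prob_space_normal_density prob_space_imp_sigma_finite)
  let ?g = "\<lambda>x::real^'n. ennreal ((1 / sqrt (2 * pi)) ^ CARD('n) * exp (- (x \<bullet> x) / 2))"
  let ?T = "\<lambda>z. \<chi> i. z i :: real^'n"
  let ?h = "\<lambda>z::'n \<Rightarrow> real. \<Prod>i\<in>UNIV. ennreal (std_normal_density (z i))"
  have [measurable]: "?T \<in> borel_measurable (\<Pi>\<^sub>M i\<in>UNIV. lborel)" by measurable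
  have gT: "?g (?T z) = ?h z" for z
  proof -
    have "(\<Prod>i\<in>UNIV. std_normal_density (z i)) = (1 / sqrt (2 * pi)) ^ CARD('n) * exp (- (?T z \<bullet> ?T z) / 2)"
      unfolding std_normal_density_def prod.distrib exp_sum[symmetric, OF finite]
      by (simp add: inner_vec_def sum_negf sum_divide_distrib power2_eq_square)
    then show ?thesis by (simp add: prod_ennreal)
  qed
  have "density (\<Pi>\<^sub>M i\<in>UNIV. lborel) ?h = (\<Pi>\<^sub>M i\<in>(UNIV::'n set). std_normal_distribution)"
  proof (rule N.PiM_eqI)
    fix A :: "'n \<Rightarrow> real set" assume A: "\<And>i. i \<in> UNIV \<Longrightarrow> A i \<in> sets std_normal_distribution"
    then have [measurable]: "A i \<in> sets borel" for i by simp
    have PA: "Pi\<^sub>E UNIV A \<in> sets (\<Pi>\<^sub>M i\<in>UNIV. lborel)" by (intro sets_PiM_I_finite) auto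
    have "emeasure (density (\<Pi>\<^sub>M i\<in>UNIV. lborel) ?h) (Pi\<^sub>E UNIV A)
      = (\<integral>\<^sup>+z. ?h z * indicator (Pi\<^sub>E UNIV A) z \<partial>(\<Pi>\<^sub>M i\<in>UNIV. lborel))"
      using PA by (intro emeasure_density) measurable
    also have "\<dots> = (\<integral>\<^sup>+z. (\<Prod>i\<in>UNIV. ennreal (std_normal_density (z i)) * indicator (A i) (z i)) \<partial>(\<Pi>\<^sub>M i\<in>UNIV. lborel))"
    proof (intro nn_integral_cong)
      fix z :: "'n \<Rightarrow> real"
      have "indicator (Pi\<^sub>E UNIV A) z = (\<Prod>i\<in>UNIV. indicator (A i) (z i) :: ennreal)"
        by (auto simp: indicator_def PiE_iff prod_zero_iff)
      then show "?h z * indicator (Pi\<^sub>E UNIV A) z = (\<Prod>i\<in>UNIV. ennreal (std_normal_density (z i)) * indicator (A i) (z i))"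
        by (simp add: prod.distrib)
    qed
    also have "\<dots> = (\<Prod>i\<in>UNIV. (\<integral>\<^sup>+x. ennreal (std_normal_density x) * indicator (A i) x \<partial>lborel))"
      by (rule product_nn_integral_prod) auto
    also have "\<dots> = (\<Prod>i\<in>UNIV. emeasure std_normal_distribution (A i))"
      by (simp add: emeasure_density)
    finally show "emeasure (density (\<Pi>\<^sub>M i\<in>UNIV. lborel) ?h) (Pi\<^sub>E UNIV A)
      = (\<Prod>i\<in>UNIV. emeasure std_normal_distribution (A i))" .
  qed (auto intro!: sets_PiM_cong)
  then have "std_normal_vec = distr (density (\<Pi>\<^sub>M i\<in>UNIV. lborel) (\<lambda>z. ?g (?T z))) borel ?T"
    unfolding gT std_normal_vec_def by (simp only:)
  also have "\<dots> = density (distr (\<Pi>\<^sub>M i\<in>UNIV. lborel) borel ?T) ?g"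
    by (rule density_distr[symmetric]) simp_all
  finally show ?thesis by (simp add: lborel_vec[symmetric])
qed

lemma prob_space_std_normal_vec: "prob_space std_normal_vec"
  unfolding std_normal_vec_def
  by (intro prob_space.prob_space_distr prob_space_PiM prob_space_normal_density) auto

lemma sets_std_normal_vec [simp, measurable_cong]: "sets std_normal_vec = sets borel"
  by (simp add: std_normal_vec_def)

theorem std_normal_vec_rotation_invariant:
  fixes R :: "real^'n^'n"
  assumes R: "orthogonal_matrix R"
  shows "distr std_normal_vec borel ((*v) R) = std_normal_vec"
proof -
  let ?g = "\<lambda>x::real^'n. ennreal ((1 / sqrt (2 * pi)) ^ CARD('n) * exp (- (x \<bullet> x) / 2))"
  have ot: "orthogonal_transformation ((*v) R)"
    using R by (simp add: orthogonal_transformation_matrix)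
  have [measurable]: "(*v) R \<in> borel_measurable borel"
    by (intro borel_measurable_continuous_onI continuous_intros)
  have "emeasure (distr lborel borel ((*v) R)) A = emeasure lborel A" if [measurable]: "A \<in> sets borel" for A
  proof -
    have "emeasure (distr lborel borel ((*v) R)) A = (\<integral>\<^sup>+x. indicator A x \<partial>distr lborel borel ((*v) R))"
      by simp
    also have "\<dots> = (\<integral>\<^sup>+x. indicator A (R *v x) \<partial>lborel)"
      by (rule nn_integral_distr) simp_all
    also have "\<dots> = (\<integral>\<^sup>+x. indicator A x \<partial>lborel)"
      by (rule nn_integral_lborel_orthogonal[OF ot]) simp
    finally show ?thesis by simp
  qed
  then have L: "distr lborel borel ((*v) R) = lborel"
    by (intro measure_eqI) auto
  have "?g (R *v x) = ?g x" for x
    using ot by (simp add: orthogonal_transformation_def)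
  then have "density lborel ?g = density lborel (\<lambda>x. ?g (R *v x))" by simp
  then have "distr std_normal_vec borel ((*v) R) = distr (density lborel (\<lambda>x. ?g (R *v x))) borel ((*v) R)"
    by (simp only: std_normal_vec_density)
  also have "\<dots> = density (distr lborel borel ((*v) R)) ?g"
    by (rule density_distr[symmetric]) measurable
  finally show ?thesis by (simp add: L std_normal_vec_density)
qed

lemma orthonormal_rows_complete:
  fixes V :: "real^'p^'r"
  assumes V: "V ** transpose V = mat 1" and card: "CARD('r) \<le> CARD('p)"
  obtains R :: "real^'p^'p" and \<iota> :: "'r \<Rightarrow> 'p"
  where "orthogonal_matrix R" "inj \<iota>" "\<And>i. R $ \<iota> i = V $ i"
proof -
  have dot: "V $ i \<bullet> V $ j = (if i = j then 1 else 0)" for i j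
    using arg_cong[OF V, of "\<lambda>M. M $ i $ j"] by (simp add: matrix_rows_inner mat_def)
  obtain \<iota> :: "'r \<Rightarrow> 'p" where \<iota>: "inj \<iota>"
    using card_le_inj[of "UNIV :: 'r set" "UNIV :: 'p set"] card by auto
  obtain v where v: "\<And>k. k \<in> range \<iota> \<Longrightarrow> v k = V $ inv \<iota> k"
    "\<And>k l. k \<in> UNIV \<Longrightarrow> l \<in> UNIV \<Longrightarrow> v k \<bullet> v l = (if k = l then 1 else 0)"
  proof (rule orthonormal_family_extend[of UNIV "range \<iota>" "\<lambda>k. V $ inv \<iota> k"])
    show "V $ inv \<iota> k \<bullet> V $ inv \<iota> l = (if k = l then 1 else 0)" if "k \<in> range \<iota>" "l \<in> range \<iota>" for k l
      using that \<iota> by (auto simp: dot inj_eq)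
  qed (use that in auto)
  define R where "R = (\<chi> k. v k)"
  have "R ** transpose R = mat 1"
    by (rule matrix_rows_eq_of_inner) (simp add: R_def v(2) mat_def)
  then have "orthogonal_matrix R"
    unfolding orthogonal_matrix using matrix_left_right_inverse by blast
  moreover have "R $ \<iota> i = V $ i" for i
    using v(1)[of "\<iota> i"] \<iota> by (simp add: R_def)
  ultimately show ?thesis using that \<iota> by blast
qed

text \<open>
Completing the rows of \<open>V\<close> to an orthogonal matrix and rotating turns them into distinct coordinates
of a standard normal vector, whose joint law is that of \<open>Z\<close>.
\<close>

theorem distr_weighted_squares:
  fixes V :: "real^'p^'r" and Z :: "'r \<Rightarrow> 'z \<Rightarrow> real"
  assumes V: "V ** transpose V = mat 1" and card: "CARD('r) \<le> CARD('p)"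
    and N: "prob_space N"
    and Z_indep: "prob_space.indep_vars N (\<lambda>_. borel) Z UNIV"
    and Z_distr: "\<And>i. distributed N lborel (Z i) std_normal_density"
  shows "distr std_normal_vec borel (\<lambda>x. \<Sum>i\<in>UNIV. c i * ((V *v x) $ i)\<^sup>2)
       = distr N borel (\<lambda>\<omega>. \<Sum>i\<in>UNIV. c i * (Z i \<omega>)\<^sup>2)"
proof -
  interpret N: prob_space N by fact
  obtain R :: "real^'p^'p" and \<iota> where R: "orthogonal_matrix R" "inj \<iota>" "\<And>i. R $ \<iota> i = V $ i"
    using orthonormal_rows_complete[OF V card] by metis
  define F :: "real^'p \<Rightarrow> real" where "F = (\<lambda>y. \<Sum>i\<in>UNIV. c i * (y $ \<iota> i)\<^sup>2)"
  define G :: "('r \<Rightarrow> real) \<Rightarrow> real" where "G = (\<lambda>w. \<Sum>i\<in>UNIV. c i * (w i)\<^sup>2)"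
  let ?P = "\<lambda>I. \<Pi>\<^sub>M i\<in>I. std_normal_distribution"
  have [measurable]: "(*v) R \<in> borel_measurable borel"
    by (intro borel_measurable_continuous_onI continuous_intros)
  have F[measurable]: "F \<in> borel_measurable borel" unfolding F_def by measurable
  have G[measurable]: "G \<in> borel_measurable (\<Pi>\<^sub>M i\<in>UNIV. borel)" unfolding G_def by measurable
  have [measurable_cong]: "sets (?P UNIV :: ('r \<Rightarrow> real) measure) = sets (\<Pi>\<^sub>M i\<in>UNIV. borel)"
    by (intro sets_PiM_cong) auto
  have [measurable_cong]: "sets (?P UNIV :: ('p \<Rightarrow> real) measure) = sets (\<Pi>\<^sub>M i\<in>UNIV. borel)"
    by (intro sets_PiM_cong) auto
  have Zm[measurable]: "Z i \<in> borel_measurable N" for i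
    using distributed_measurable[OF Z_distr[of i]] by simp
  have Zd: "distr N borel (Z i) = std_normal_distribution" for i
  proof -
    have "distr N borel (Z i) = distr N lborel (Z i)" by (rule distr_cong) auto
    then show ?thesis using distributed_distr_eq_density[OF Z_distr[of i]] by simp
  qed
  have "(V *v x) $ i = (R *v x) $ \<iota> i" for x i
    by (simp add: matrix_vector_mult_def R(3))
  then have "distr std_normal_vec borel (\<lambda>x. \<Sum>i\<in>UNIV. c i * ((V *v x) $ i)\<^sup>2)
      = distr std_normal_vec borel (F \<circ> (*v) R)"
    by (simp add: F_def comp_def)
  also have "\<dots> = distr (distr std_normal_vec borel ((*v) R)) borel F"
    by (rule distr_distr[symmetric]) measurable
  also have "\<dots> = distr std_normal_vec borel F"
    by (simp add: std_normal_vec_rotation_invariant[OF R(1)])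
  also have "\<dots> = distr (?P UNIV) borel (F \<circ> (\<lambda>z. \<chi> i. z i))"
    unfolding std_normal_vec_def by (rule distr_distr) measurable
  also have "\<dots> = distr (?P UNIV) borel (G \<circ> (\<lambda>z. \<lambda>i\<in>UNIV. z (\<iota> i)))"
    by (simp add: F_def G_def comp_def)
  also have "\<dots> = distr (distr (?P UNIV) (?P UNIV) (\<lambda>z. \<lambda>i\<in>UNIV. z (\<iota> i))) borel G"
    by (rule distr_distr[symmetric]) measurable
  also have "distr (?P UNIV) (?P UNIV) (\<lambda>z. \<lambda>i\<in>UNIV. z (\<iota> i)) = (?P UNIV)"
    by (rule distr_PiM_reindex) (auto simp: R(2) prob_space_normal_density)
  also have "?P UNIV = distr N (\<Pi>\<^sub>M i\<in>UNIV. borel) (\<lambda>\<omega>. \<lambda>i\<in>UNIV. Z i \<omega>)"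
    using N.indep_vars_iff_distr_eq_PiM[where I = UNIV and M' = "\<lambda>_. borel" and X = Z] Z_indep by (simp add: Zd)
  also have "distr \<dots> borel G = distr N borel (G \<circ> (\<lambda>\<omega>. \<lambda>i\<in>UNIV. Z i \<omega>))"
    by (rule distr_distr) measurable
  finally show ?thesis by (simp add: G_def comp_def)
qed

section \<open>Weak convergence of nearly continuous images\<close>

text \<open>
A variant of Slutsky's theorem combined with the continuous mapping theorem.  Convergence of the
distribution functions follows once the expectations of the functions \<open>cts_step x y\<close> converge, and these are
uniformly continuous.  If \<open>T n\<close> is bounded, \<open>W n\<close> may be replaced by \<open>h (T n)\<close>; the event that \<open>T n\<close> is
large has small probability, since the limit \<open>\<nu>\<close> has small mass far out and this carries over to the
laws of \<open>T n\<close> by testing with a continuous cutoff.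
\<close>

theorem weak_conv_bc_imp_weak_conv_m:
  fixes T :: "nat \<Rightarrow> 'w \<Rightarrow> 'a::euclidean_space" and W :: "nat \<Rightarrow> 'w \<Rightarrow> real"
  assumes P: "prob_space P"
    and T[measurable]: "\<And>n. T n \<in> borel_measurable P"
    and W[measurable]: "\<And>n. W n \<in> borel_measurable P"
    and \<nu>: "prob_space \<nu>" and \<nu>_sets[measurable_cong]: "sets \<nu> = sets borel"
    and conv: "weak_conv_bc (\<lambda>n. distr P borel (T n)) \<nu>"
    and h: "continuous_on UNIV h"
    and close: "\<And>K e. e > 0 \<Longrightarrow>
      eventually (\<lambda>n. AE \<omega> in P. norm (T n \<omega>) \<le> K \<longrightarrow> \<bar>W n \<omega> - h (T n \<omega>)\<bar> \<le> e) sequentially"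
  shows "weak_conv_m (\<lambda>n. distr P borel (W n)) (distr \<nu> borel h)"
proof -
  interpret P: prob_space P by fact
  interpret \<nu>: prob_space \<nu> by fact
  have hm[measurable]: "h \<in> borel_measurable borel"
    using h by (rule borel_measurable_continuous_onI)
  have conv': "(\<lambda>n. \<integral>\<omega>. k (T n \<omega>) \<partial>P) \<longlonglongrightarrow> (\<integral>t. k t \<partial>\<nu>)"
    if k: "continuous_on UNIV k" "bounded (range k)" for k :: "'a \<Rightarrow> real"
  proof -
    have [measurable]: "k \<in> borel_measurable borel" using k(1) by (rule borel_measurable_continuous_onI)
    show ?thesis
      using conv[unfolded weak_conv_bc_def, rule_format, OF k] by (simp add: integral_distr)
  qed
  show ?thesis
  proof (rule integral_cts_step_conv_imp_weak_conv)
    show "real_distribution (distr P borel (W n))" for n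
      by (rule P.real_distribution_distr) simp
    show "real_distribution (distr \<nu> borel h)"
      by (rule \<nu>.real_distribution_distr) simp
  next
    fix x y :: real assume xy: "x < y"
    define \<phi> where "\<phi> = cts_step x y"
    have ucont: "uniformly_continuous_on UNIV \<phi>"
      unfolding \<phi>_def by (rule cts_step_uniformly_continuous[OF xy])
    have \<phi>cont: "continuous_on UNIV \<phi>" using ucont by (rule uniformly_continuous_imp_continuous)
    have \<phi>m[measurable]: "\<phi> \<in> borel_measurable borel"
      using \<phi>cont by (rule borel_measurable_continuous_onI)
    have \<phi>01: "0 \<le> \<phi> t" "\<phi> t \<le> 1" for t
      using xy by (auto simp: \<phi>_def cts_step_def field_simps)
    \<comment> \<open>A continuous cutoff, which carries the smallness of the tails of \<open>\<nu>\<close> over to the laws of \<open>T n\<close>.\<close>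
    define \<tau> :: "nat \<Rightarrow> 'a \<Rightarrow> real" where "\<tau> K t = min 1 (max 0 (norm t - real K))" for K t
    have \<tau>cont: "continuous_on UNIV (\<tau> K)" for K unfolding \<tau>_def by (intro continuous_intros)
    have \<tau>m[measurable]: "\<tau> K \<in> borel_measurable borel" for K
      using \<tau>cont by (rule borel_measurable_continuous_onI)
    have \<tau>01: "0 \<le> \<tau> K t" "\<tau> K t \<le> 1" for K t by (auto simp: \<tau>_def)
    have \<tau>lim: "(\<lambda>K. \<integral>t. \<tau> K t \<partial>\<nu>) \<longlonglongrightarrow> 0"
    proof -
      have "(\<lambda>K. \<integral>t. \<tau> K t \<partial>\<nu>) \<longlonglongrightarrow> (\<integral>t. 0 \<partial>\<nu>)"
      proof (rule integral_dominated_convergence[where w = "\<lambda>_. 1"])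
        show "AE t in \<nu>. (\<lambda>K. \<tau> K t) \<longlonglongrightarrow> 0"
        proof (rule AE_I2)
          fix t :: "'a"
          obtain K0 :: nat where "norm t \<le> real K0" using real_arch_simple by blast
          then have "eventually (\<lambda>K. \<tau> K t = 0) sequentially"
            by (intro eventually_sequentiallyI[of K0]) (auto simp: \<tau>_def)
          then show "(\<lambda>K. \<tau> K t) \<longlonglongrightarrow> 0" by (rule tendsto_eventually)
        qed
        show "AE t in \<nu>. norm (\<tau> K t) \<le> 1" for K using \<tau>01 by simp
      qed simp_all
      then show ?thesis by simp
    qed
    have bdd: "bounded (range k)" if "\<And>t. 0 \<le> k t" "\<And>t. k t \<le> 1" for k :: "'a \<Rightarrow> real"
      by (rule boundedI[of _ 1]) (use that in auto)
    have lim1: "(\<lambda>n. \<integral>\<omega>. \<phi> (h (T n \<omega>)) \<partial>P) \<longlonglongrightarrow> (\<integral>t. \<phi> (h t) \<partial>\<nu>)"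
      by (rule conv'[OF continuous_on_compose2[OF \<phi>cont h] bdd]) (auto simp: \<phi>01)
    have lim2: "(\<lambda>n. (\<integral>\<omega>. \<phi> (W n \<omega>) \<partial>P) - (\<integral>\<omega>. \<phi> (h (T n \<omega>)) \<partial>P)) \<longlonglongrightarrow> 0"
    proof (rule LIMSEQ_I)
      fix e :: real assume e: "e > 0"
      then obtain d where d: "d > 0" "\<And>a b. \<bar>a - b\<bar> < d \<Longrightarrow> \<bar>\<phi> a - \<phi> b\<bar> < e / 3"
        using ucont[unfolded uniformly_continuous_on_def dist_real_def, rule_format, of "e / 3"] by auto
      have "eventually (\<lambda>K. (\<integral>t. \<tau> K t \<partial>\<nu>) < e / 3) sequentially"
        using e by (intro order_tendstoD(2)[OF \<tau>lim]) simp
      from eventually_happens'[OF sequentially_bot this]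
      obtain K where K: "(\<integral>t. \<tau> K t \<partial>\<nu>) < e / 3" ..
      have ev1: "eventually (\<lambda>n. (\<integral>\<omega>. \<tau> K (T n \<omega>) \<partial>P) < e / 3) sequentially"
        by (rule order_tendstoD(2)[OF conv'[OF \<tau>cont bdd] K]) (simp_all add: \<tau>01)
      have "eventually (\<lambda>n. AE \<omega> in P. norm (T n \<omega>) \<le> real K + 1 \<longrightarrow>
          \<bar>W n \<omega> - h (T n \<omega>)\<bar> \<le> d / 2) sequentially"
        using d(1) by (intro close) simp
      with ev1 have "eventually (\<lambda>n. norm ((\<integral>\<omega>. \<phi> (W n \<omega>) \<partial>P) - (\<integral>\<omega>. \<phi> (h (T n \<omega>)) \<partial>P) - 0) < e) sequentially"
      proof eventually_elim
        case (elim n)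
        have iW: "integrable P (\<lambda>\<omega>. \<phi> (W n \<omega>))" and iT: "integrable P (\<lambda>\<omega>. \<phi> (h (T n \<omega>)))"
          and i\<tau>: "integrable P (\<lambda>\<omega>. \<tau> K (T n \<omega>))"
          by (rule P.integrable_const_bound[of _ 1]; use \<phi>01 \<tau>01 in simp)+
        have "AE \<omega> in P. \<bar>\<phi> (W n \<omega>) - \<phi> (h (T n \<omega>))\<bar> \<le> e / 3 + \<tau> K (T n \<omega>)"
          using elim(2)
        proof eventually_elim
          case (elim \<omega>)
          show ?case
          proof (cases "norm (T n \<omega>) \<le> real K + 1")
            case True
            with elim d(1) have "\<bar>W n \<omega> - h (T n \<omega>)\<bar> < d" by auto
            from d(2)[OF this] show ?thesis using \<tau>01(1)[of K "T n \<omega>"] by linarith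
          next
            case False
            then have "\<tau> K (T n \<omega>) = 1" by (simp add: \<tau>_def)
            then show ?thesis
              using \<phi>01[of "W n \<omega>"] \<phi>01[of "h (T n \<omega>)"] e by linarith
          qed
        qed
        then have "(\<integral>\<omega>. \<bar>\<phi> (W n \<omega>) - \<phi> (h (T n \<omega>))\<bar> \<partial>P) \<le> (\<integral>\<omega>. e / 3 + \<tau> K (T n \<omega>) \<partial>P)"
          using iW iT i\<tau> by (intro integral_mono_AE) auto
        also have "\<dots> = e / 3 + (\<integral>\<omega>. \<tau> K (T n \<omega>) \<partial>P)"
          using i\<tau> by (simp add: P.prob_space)
        also have "\<dots> < e" using elim(1) e by simp
        finally have "(\<integral>\<omega>. \<bar>\<phi> (W n \<omega>) - \<phi> (h (T n \<omega>))\<bar> \<partial>P) < e" .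
        moreover have "(\<integral>\<omega>. \<phi> (W n \<omega>) \<partial>P) - (\<integral>\<omega>. \<phi> (h (T n \<omega>)) \<partial>P)
            = (\<integral>\<omega>. \<phi> (W n \<omega>) - \<phi> (h (T n \<omega>)) \<partial>P)"
          using iW iT by simp
        moreover have "\<bar>\<integral>\<omega>. \<phi> (W n \<omega>) - \<phi> (h (T n \<omega>)) \<partial>P\<bar> \<le> (\<integral>\<omega>. \<bar>\<phi> (W n \<omega>) - \<phi> (h (T n \<omega>))\<bar> \<partial>P)"
          by (rule integral_abs_bound)
        ultimately show ?case unfolding diff_0_right real_norm_def by linarith
      qed
      then show "\<exists>n0. \<forall>n\<ge>n0. norm ((\<integral>\<omega>. \<phi> (W n \<omega>) \<partial>P) - (\<integral>\<omega>. \<phi> (h (T n \<omega>)) \<partial>P) - 0) < e"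
        by (simp add: eventually_sequentially)
    qed
    from tendsto_add[OF lim2 lim1]
    have "(\<lambda>n. \<integral>\<omega>. \<phi> (W n \<omega>) \<partial>P) \<longlonglongrightarrow> (\<integral>t. \<phi> (h t) \<partial>\<nu>)" by simp
    then show "(\<lambda>n. integral\<^sup>L (distr P borel (W n)) (cts_step x y))
        \<longlonglongrightarrow> integral\<^sup>L (distr \<nu> borel h) (cts_step x y)"
      unfolding \<phi>_def[symmetric] by (simp add: integral_distr)
  qed
qed

section \<open>Continuity of matrix inversion\<close>

lemma matrix_inv_right:
  fixes A :: "real^'n^'n"
  assumes "invertible A"
  shows "A ** matrix_inv A = mat 1"
  using someI_ex[of "\<lambda>B. A ** B = mat 1 \<and> B ** A = mat 1"] assms
  by (auto simp: matrix_inv_def invertible_def)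

lemma matrix_inv_cramer:
  fixes A :: "real^'n^'n"
  assumes A: "invertible A"
  shows "matrix_inv A $ k $ j = det (\<chi> i l. if l = k then mat 1 $ i $ j else A $ i $ l) / det A"
proof -
  have "A *v column j (matrix_inv A) = column j (A ** matrix_inv A)"
    by (simp add: vec_eq_iff column_def matrix_vector_mult_def matrix_matrix_mult_def)
  also have "\<dots> = column j (mat 1)" by (simp add: matrix_inv_right[OF A])
  finally have "column j (matrix_inv A) = (\<chi> k. det (\<chi> i l. if l = k then column j (mat 1) $ i else A $ i $ l) / det A)"
    using A by (subst cramer[symmetric]) (simp_all add: invertible_det_nz)
  from arg_cong[OF this, of "\<lambda>v. v $ k"] show ?thesis by (simp add: column_def cong: if_cong)
qed

text \<open>
By Cramer's rule the entries of the inverse are quotients of determinants.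
\<close>

lemma tendsto_matrix_inv:
  fixes A :: "'a \<Rightarrow> real^'n^'n"
  assumes A: "(A \<longlongrightarrow> L) F" and L: "invertible L"
  shows "((\<lambda>x. matrix_inv (A x)) \<longlongrightarrow> matrix_inv L) F"
proof (intro vec_tendstoI)
  fix k j
  have det0: "det L \<noteq> 0" using L by (simp add: invertible_det_nz)
  have "((\<lambda>x. \<chi> i l. if l = k then mat 1 $ i $ j else A x $ i $ l) \<longlongrightarrow>
      (\<chi> i l. if l = k then mat 1 $ i $ j else L $ i $ l)) F"
    by (intro vec_tendstoI) (auto intro!: tendsto_intros A)
  then have "((\<lambda>x. det (\<chi> i l. if l = k then mat 1 $ i $ j else A x $ i $ l) / det (A x))
      \<longlongrightarrow> det (\<chi> i l. if l = k then mat 1 $ i $ j else L $ i $ l) / det L) F"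
    by (intro tendsto_divide tendsto_det A det0)
  moreover have "eventually (\<lambda>x. det (A x) \<noteq> 0) F"
    by (rule tendsto_imp_eventually_ne[OF tendsto_det[OF A] det0])
  then have "eventually (\<lambda>x. det (\<chi> i l. if l = k then mat 1 $ i $ j else A x $ i $ l) / det (A x)
      = matrix_inv (A x) $ k $ j) F"
    by eventually_elim (simp add: matrix_inv_cramer invertible_det_nz)
  ultimately show "((\<lambda>x. matrix_inv (A x) $ k $ j) \<longlongrightarrow> matrix_inv L $ k $ j) F"
    unfolding matrix_inv_cramer[OF L] by (rule Lim_transform_eventually)
qed

lemma transpose_matrix_inv:
  fixes A :: "real^'n^'n"
  assumes "invertible A"
  shows "transpose (matrix_inv A) = matrix_inv (transpose A)"
proof -
  have "transpose (matrix_inv A) = transpose (matrix_inv A) ** (transpose A ** matrix_inv (transpose A))"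
    using matrix_inv_right[OF transpose_invertible[OF assms]] by simp
  also have "\<dots> = transpose (A ** matrix_inv A) ** matrix_inv (transpose A)"
    by (simp add: matrix_transpose_mul matrix_mul_assoc)
  also have "\<dots> = matrix_inv (transpose A)" by (simp add: matrix_inv_right[OF assms])
  finally show ?thesis .
qed

section \<open>The delta method for quadratic forms\<close>

text \<open>
With \<open>\<theta> = \<theta>0 + t / sqrt n\<close>, \<open>y = sqrt n m(\<theta>)\<close> and \<open>y0 = m' t\<close>, the two forms are \<open>y \<bullet> S(\<theta>) y\<close> and
\<open>y0 \<bullet> S(\<theta>0) y0\<close>.  Differentiability of \<open>m\<close> bounds \<open>y - y0\<close> by \<open>\<eta> K\<close> and continuity bounds
\<open>S(\<theta>) - S(\<theta>0)\<close> by \<open>\<eta>\<close>, uniformly in the \<open>t\<close> considered, as soon as \<open>K / sqrt n\<close> is small enough for \<open>\<eta>\<close>.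
\<close>

theorem quadratic_delta_method:
  fixes m :: "real^'p \<Rightarrow> real^'r" and S :: "real^'p \<Rightarrow> real^'r^'r"
  assumes m: "(m has_derivative m') (at \<theta>0)" "m \<theta>0 = 0"
    and S: "(S \<longlongrightarrow> S \<theta>0) (at \<theta>0 within A)" and e: "e > 0"
  shows "eventually (\<lambda>n. \<forall>t. norm t \<le> K \<longrightarrow> \<theta>0 + t /\<^sub>R sqrt (real n) \<in> A \<longrightarrow>
    \<bar>real n * (m (\<theta>0 + t /\<^sub>R sqrt (real n)) \<bullet> (S (\<theta>0 + t /\<^sub>R sqrt (real n)) *v m (\<theta>0 + t /\<^sub>R sqrt (real n))))
      - m' t \<bullet> (S \<theta>0 *v m' t)\<bar> \<le> e) sequentially"
proof -
  have bl: "bounded_linear m'" using m(1) by (rule has_derivative_bounded_linear)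
  obtain Cm where Cm: "Cm > 0" "\<And>t. norm (m' t) \<le> norm t * Cm"
    using bounded_linear.pos_bounded[OF bl] by blast
  have bb: "bounded_bilinear ((*v) :: real^'r^'r \<Rightarrow> real^'r \<Rightarrow> real^'r)"
    unfolding bilinear_conv_bounded_bilinear[symmetric] bilinear_def
    by (auto intro!: linearI simp: vec_eq_iff matrix_vector_mult_def algebra_simps sum.distrib sum_distrib_left)
  obtain B where B: "B > 0" "\<And>M v. norm (M *v v) \<le> norm (M::real^'r^'r) * norm (v::real^'r) * B"
    using bounded_bilinear.pos_bounded[OF bb] by blast
  define k where "k = max K 0"
  define c where "c = k * Cm"
  define s where "s = norm (S \<theta>0)"
  have nn: "k \<ge> 0" "c \<ge> 0" "s \<ge> 0" using Cm(1) by (auto simp: k_def c_def s_def)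
  \<comment> \<open>The resulting bound for the error, one summand for each term of the decomposition of the difference below.\<close>
  define E where "E \<eta> = (\<eta> * k) * ((s + \<eta>) * (c + \<eta> * k) * B) + c * (\<eta> * (c + \<eta> * k) * B) + c * (s * (\<eta> * k) * B)" for \<eta>
  have "(E \<longlongrightarrow> E 0) (at_right 0)"
    unfolding E_def by (intro tendsto_intros)
  moreover have "E 0 < e" using e by (simp add: E_def)
  ultimately have "eventually (\<lambda>\<eta>. E \<eta> < e) (at_right 0)"
    by (rule order_tendstoD(2))
  moreover have "eventually (\<lambda>\<eta>. \<eta> > 0) (at_right (0::real))"
    by (rule eventually_at_right_less)
  ultimately have "eventually (\<lambda>\<eta>. E \<eta> < e \<and> \<eta> > 0) (at_right 0)" by eventually_elim simp
  from eventually_happens'[OF trivial_limit_at_right_real this]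
  obtain \<eta> where \<eta>: "E \<eta> < e" "\<eta> > 0" by blast
  obtain d1 where d1: "d1 > 0" "\<And>y. norm (y - \<theta>0) < d1 \<Longrightarrow> norm (m y - m \<theta>0 - m' (y - \<theta>0)) \<le> \<eta> * norm (y - \<theta>0)"
    using m(1) \<eta>(2) unfolding has_derivative_at_alt by blast
  obtain d2 where d2: "d2 > 0" "\<And>y. y \<in> A \<Longrightarrow> y \<noteq> \<theta>0 \<Longrightarrow> dist y \<theta>0 < d2 \<Longrightarrow> dist (S y) (S \<theta>0) < \<eta>"
    using tendstoD[OF S \<eta>(2)] unfolding eventually_at by blast
  have "(\<lambda>n. k / sqrt (real n)) \<longlonglongrightarrow> 0"
    by (intro tendsto_divide_0[OF tendsto_const] filterlim_compose[OF sqrt_at_top filterlim_real_sequentially]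
        filterlim_at_top_imp_at_infinity)
  then have "eventually (\<lambda>n. k / sqrt (real n) < min d1 d2) sequentially"
    using d1(1) d2(1) by (intro order_tendstoD(2)) auto
  with eventually_gt_at_top[of 0] show ?thesis
  proof eventually_elim
    case (elim n)
    show ?case
    proof (intro allI impI)
      fix t assume t: "norm t \<le> K" and inA: "\<theta>0 + t /\<^sub>R sqrt (real n) \<in> A"
      define r where "r = sqrt (real n)"
      have r: "r > 0" "r * r = real n" using elim(1) by (auto simp: r_def)
      define \<theta> where "\<theta> = \<theta>0 + t /\<^sub>R r"
      have tk: "norm t \<le> k" using t by (simp add: k_def)
      have diff: "\<theta> - \<theta>0 = t /\<^sub>R r" by (simp add: \<theta>_def)
      have nd: "norm (\<theta> - \<theta>0) = norm t / r" unfolding diff using r by (simp add: divide_inverse mult.commute)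
      also have "\<dots> \<le> k / r" using tk r by (simp add: divide_right_mono)
      finally have small: "norm (\<theta> - \<theta>0) < d1" "norm (\<theta> - \<theta>0) < d2" using elim(2) by (auto simp: r_def)
      define y where "y = r *\<^sub>R m \<theta>"
      define y0 where "y0 = m' t"
      have "y - y0 = r *\<^sub>R (m \<theta> - m \<theta>0 - m' (\<theta> - \<theta>0))"
        using r bl by (simp add: y_def y0_def diff m(2) linear_cmul[OF bounded_linear.linear] algebra_simps)
      then have "norm (y - y0) = r * norm (m \<theta> - m \<theta>0 - m' (\<theta> - \<theta>0))" using r by simp
      also have "\<dots> \<le> r * (\<eta> * (norm t / r))"
        using d1(2)[OF small(1)] r by (intro mult_left_mono) (simp_all add: nd)
      also have "\<dots> = \<eta> * norm t" using r by simp
      also have "\<dots> \<le> \<eta> * k" using tk \<eta> by (intro mult_left_mono) auto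
      finally have yd: "norm (y - y0) \<le> \<eta> * k" .
      have y0: "norm y0 \<le> c"
        unfolding y0_def c_def using Cm(1) by (intro order_trans[OF Cm(2)] mult_right_mono tk) simp
      have yn: "norm y \<le> c + \<eta> * k" using norm_triangle_ineq[of y0 "y - y0"] yd y0 by simp
      have Sd: "norm (S \<theta> - S \<theta>0) \<le> \<eta>"
        using d2(2)[of \<theta>] inA small(2) \<eta>(2) by (cases "\<theta> = \<theta>0") (auto simp: dist_norm \<theta>_def r_def)
      have Sn: "norm (S \<theta>) \<le> s + \<eta>" using norm_triangle_ineq[of "S \<theta>0" "S \<theta> - S \<theta>0"] Sd by (simp add: s_def)
      have 1: "\<bar>(y - y0) \<bullet> (S \<theta> *v y)\<bar> \<le> (\<eta> * k) * ((s + \<eta>) * (c + \<eta> * k) * B)"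
      proof -
        have "norm (S \<theta> *v y) \<le> (s + \<eta>) * (c + \<eta> * k) * B"
          by (rule order_trans[OF B(2)]) (intro mult_right_mono mult_mono Sn yn; use nn \<eta> B in simp)
        then show ?thesis
          by (intro order_trans[OF Cauchy_Schwarz_ineq2] mult_mono yd) (use nn \<eta> in auto)
      qed
      have 2: "\<bar>y0 \<bullet> ((S \<theta> - S \<theta>0) *v y)\<bar> \<le> c * (\<eta> * (c + \<eta> * k) * B)"
      proof -
        have "norm ((S \<theta> - S \<theta>0) *v y) \<le> \<eta> * (c + \<eta> * k) * B"
          by (rule order_trans[OF B(2)]) (intro mult_right_mono mult_mono Sd yn; use nn \<eta> B in simp)
        then show ?thesis
          by (intro order_trans[OF Cauchy_Schwarz_ineq2] mult_mono y0) (use nn \<eta> in auto)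
      qed
      have 3: "\<bar>y0 \<bullet> (S \<theta>0 *v (y - y0))\<bar> \<le> c * (s * (\<eta> * k) * B)"
      proof -
        have "norm (S \<theta>0 *v (y - y0)) \<le> s * (\<eta> * k) * B"
          by (rule order_trans[OF B(2)]) (unfold s_def, intro mult_right_mono mult_left_mono yd; use nn \<eta> B in simp)
        then show ?thesis
          by (intro order_trans[OF Cauchy_Schwarz_ineq2] mult_mono y0) (use nn \<eta> in auto)
      qed
      have "y \<bullet> (S \<theta> *v y) - y0 \<bullet> (S \<theta>0 *v y0)
          = (y - y0) \<bullet> (S \<theta> *v y) + y0 \<bullet> ((S \<theta> - S \<theta>0) *v y) + y0 \<bullet> (S \<theta>0 *v (y - y0))"
        by (simp add: inner_diff_left inner_diff_right matrix_vector_mult_diff_rdistrib matrix_vector_mult_diff_distrib)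
      with 1 2 3 have "\<bar>y \<bullet> (S \<theta> *v y) - y0 \<bullet> (S \<theta>0 *v y0)\<bar> \<le> E \<eta>" unfolding E_def by linarith
      moreover have "real n * (m \<theta> \<bullet> (S \<theta> *v m \<theta>)) = y \<bullet> (S \<theta> *v y)"
        by (simp add: y_def r(2)[symmetric] matrix_vector_mult_scaleR mult.assoc)
      ultimately show "\<bar>real n * (m (\<theta>0 + t /\<^sub>R sqrt (real n)) \<bullet> (S (\<theta>0 + t /\<^sub>R sqrt (real n)) *v m (\<theta>0 + t /\<^sub>R sqrt (real n))))
          - m' t \<bullet> (S \<theta>0 *v m' t)\<bar> \<le> e"
        using \<eta>(1) by (simp add: \<theta>_def r_def y0_def)
    qed
  qed
qed

section \<open>The Wald statistic\<close>

lemma bounded_linear_transpose: "bounded_linear (transpose :: real^'n^'m \<Rightarrow> real^'m^'n)"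
  unfolding linear_conv_bounded_linear[symmetric]
  by (auto intro!: linearI simp: vec_eq_iff transpose_def)

lemma transpose_outer_self: "transpose (outer u u) = outer u u"
  by (simp add: outer_def transpose_def vec_eq_iff mult.commute)

lemma transpose_integral_outer_self:
  assumes "integrable M (\<lambda>x. w x *\<^sub>R outer (u x) (u x))"
  shows "transpose (\<integral>x. w x *\<^sub>R outer (u x) (u x) \<partial>M) = (\<integral>x. w x *\<^sub>R outer (u x) (u x) \<partial>M)"
proof -
  have "transpose (\<integral>x. w x *\<^sub>R outer (u x) (u x) \<partial>M) = (\<integral>x. transpose (w x *\<^sub>R outer (u x) (u x)) \<partial>M)"
    by (rule integral_bounded_linear[OF bounded_linear_transpose assms, symmetric])
  then show ?thesis
    by (simp add: linear_cmul[OF bounded_linear.linear[OF bounded_linear_transpose]] transpose_outer_self)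
qed

text \<open>
Symmetry of \<open>\<Sigma>\<^sub>\<beta>\<close> passes to the weight matrix of the Wald statistic, to which the diagonalisation of
quadratic forms is applied.
\<close>

lemma transpose_Sigma_model:
  assumes J: "integrable \<mu> (\<lambda>x. (f \<theta> x powr (1 + \<beta>)) *\<^sub>R outer (score f \<theta> x) (score f \<theta> x))"
    and K: "integrable \<mu> (\<lambda>x. (f \<theta> x powr (1 + 2 * \<beta>)) *\<^sub>R outer (score f \<theta> x) (score f \<theta> x))"
    and inv: "invertible (J_model \<mu> f \<beta> \<theta>)"
  shows "transpose (Sigma_model \<mu> f \<beta> \<theta>) = Sigma_model \<mu> f \<beta> \<theta>"
proof -
  have "transpose (J_model \<mu> f \<beta> \<theta>) = J_model \<mu> f \<beta> \<theta>"
    unfolding J_model_def by (rule transpose_integral_outer_self[OF J])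
  moreover have "transpose (K_model \<mu> f \<beta> \<theta>) = K_model \<mu> f \<beta> \<theta>"
    unfolding K_model_def
    by (simp add: linear_diff[OF bounded_linear.linear[OF bounded_linear_transpose]] transpose_integral_outer_self[OF K]
        transpose_outer_self)
  ultimately show ?thesis
    using transpose_matrix_inv[OF inv]
    by (simp add: Sigma_model_def matrix_transpose_mul matrix_mul_assoc)
qed

lemma transpose_congr_by:
  assumes "transpose (S \<theta>) = S \<theta>"
  shows "transpose (congr_by m S \<theta>) = congr_by m S \<theta>"
  using assms by (simp add: congr_by_def matrix_transpose_mul matrix_mul_assoc)

lemma tendsto_congr_by:
  assumes "(S \<longlongrightarrow> S \<theta>) F" "(deriv_transp m \<longlongrightarrow> deriv_transp m \<theta>) F"
  shows "(congr_by m S \<longlongrightarrow> congr_by m S \<theta>) F"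
  unfolding congr_by_def
  by (intro tendsto_matrix_mult bounded_linear.tendsto[OF bounded_linear_transpose] assms)

theorem theorem12:
  fixes \<mu> :: "'x measure"
    and f :: "real^'p \<Rightarrow> 'x \<Rightarrow> real"
    and \<Theta> U :: "(real^'p) set"
    and \<beta> :: real
    and g :: "'x \<Rightarrow> real"
    and m :: "real^'p \<Rightarrow> real^'r"
    and P :: "'w measure"
    and X :: "nat \<Rightarrow> 'w \<Rightarrow> 'x"
    and \<theta>h :: "nat \<Rightarrow> 'w \<Rightarrow> real^'p"
    and \<theta>\<^sub>0 :: "real^'p"
    and \<nu> :: "(real^'p) measure"
    and N :: "'z measure"
    and Z :: "'r \<Rightarrow> 'z \<Rightarrow> real"
  assumes beta: "\<beta> \<ge> 0"
    and f_density: "\<And>\<theta>. \<theta> \<in> \<Theta> \<Longrightarrow> f \<theta> \<in> borel_measurable \<mu>"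
      "\<And>\<theta> x. \<theta> \<in> \<Theta> \<Longrightarrow> x \<in> space \<mu> \<Longrightarrow> f \<theta> x \<ge> 0"
      "\<And>\<theta>. \<theta> \<in> \<Theta> \<Longrightarrow> (\<integral>\<^sup>+x. ennreal (f \<theta> x) \<partial>\<mu>) = 1"
    and g_density: "g \<in> borel_measurable \<mu>" "\<And>x. x \<in> space \<mu> \<Longrightarrow> g x \<ge> 0"
    \<comment> \<open>i.i.d. sample from the distribution G with density g\<close>
    and P: "prob_space P"
    and X_indep: "prob_space.indep_vars P (\<lambda>_. \<mu>) X UNIV"
    and X_distr: "\<And>i. distributed P \<mu> (X i) (\<lambda>x. ennreal (g x))"
    \<comment> \<open>\<open>\<theta>\<^sub>0 = T\<^sub>\<beta>(G)\<close> and \<open>\<theta>h n = T\<^sub>\<beta>(G\<^sub>n)\<close>\<close>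
    and theta0: "dpd_minimizer \<mu> f \<Theta> \<beta> (density \<mu> (\<lambda>x. ennreal (g x))) \<theta>\<^sub>0"
    and estimator: "\<And>n. n \<ge> 1 \<Longrightarrow> \<theta>h n \<in> borel_measurable P"
      "\<And>n. n \<ge> 1 \<Longrightarrow> AE \<omega> in P. dpd_minimizer \<mu> f \<Theta> \<beta> (empirical_measure \<mu> X n \<omega>) (\<theta>h n \<omega>)"
    and nbhd: "open U" "\<theta>\<^sub>0 \<in> U"
    \<comment> \<open>existence of the derivatives and integrals in the definitions\<close>
    and score_ex: "\<And>\<theta>. \<theta> \<in> U \<inter> \<Theta> \<Longrightarrow>
        AE x in \<mu>. f \<theta> x > 0 \<longrightarrow> (\<lambda>t. ln (f t x)) differentiable (at \<theta>)"
    and info_ex: "AE x in \<mu>. f \<theta>\<^sub>0 x > 0 \<longrightarrow> (\<lambda>t. score f t x) differentiable (at \<theta>\<^sub>0)"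
    and model_integrals_ex: "\<And>\<theta>. \<theta> \<in> U \<inter> \<Theta> \<Longrightarrow>
        integrable \<mu> (\<lambda>x. (f \<theta> x powr (1 + \<beta>)) *\<^sub>R score f \<theta> x)"
      "\<And>\<theta>. \<theta> \<in> U \<inter> \<Theta> \<Longrightarrow>
        integrable \<mu> (\<lambda>x. (f \<theta> x powr (1 + \<beta>)) *\<^sub>R outer (score f \<theta> x) (score f \<theta> x))"
      "\<And>\<theta>. \<theta> \<in> U \<inter> \<Theta> \<Longrightarrow>
        integrable \<mu> (\<lambda>x. (f \<theta> x powr (1 + 2 * \<beta>)) *\<^sub>R outer (score f \<theta> x) (score f \<theta> x))"
    and true_integrals_ex:
      "integrable \<mu> (\<lambda>x. (f \<theta>\<^sub>0 x powr \<beta> * g x) *\<^sub>R score f \<theta>\<^sub>0 x)"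
      "integrable \<mu> (\<lambda>x. (f \<theta>\<^sub>0 x powr (2 * \<beta>) * g x) *\<^sub>R outer (score f \<theta>\<^sub>0 x) (score f \<theta>\<^sub>0 x))"
      "integrable \<mu> (\<lambda>x. ((g x - f \<theta>\<^sub>0 x) * f \<theta>\<^sub>0 x powr \<beta>) *\<^sub>R
         (info f \<theta>\<^sub>0 x - \<beta> *\<^sub>R outer (score f \<theta>\<^sub>0 x) (score f \<theta>\<^sub>0 x)))"
    \<comment> \<open>regularity of \<open>\<Sigma>\<^sub>\<beta>\<close> and invertibility of the matrices that are inverted\<close>
    and Sigma_cont: "continuous_on (U \<inter> \<Theta>) (Sigma_model \<mu> f \<beta>)"
    and J_inv: "\<And>\<theta>. \<theta> \<in> U \<inter> \<Theta> \<Longrightarrow> invertible (J_model \<mu> f \<beta> \<theta>)"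
    and Jg_inv: "invertible (J_true \<mu> f \<beta> g \<theta>\<^sub>0)"
    and Sigma_star_inv: "invertible (congr_by m (Sigma_model \<mu> f \<beta>) \<theta>\<^sub>0)"
    \<comment> \<open>the restriction function m\<close>
    and dims: "CARD('r) \<le> CARD('p)"
    and m_diff: "\<And>\<theta>. \<theta> \<in> U \<Longrightarrow> m differentiable (at \<theta>)"
    and M_cont: "continuous_on U (deriv_transp m)"
    and M_rank: "rank (deriv_transp m \<theta>\<^sub>0) = CARD('r)"
    \<comment> \<open>asymptotic normality of the estimator\<close>
    and normal_limit: "multivariate_normal \<nu> 0 (Sigma_true \<mu> f \<beta> g \<theta>\<^sub>0)"
    and asymp_normal:
      "weak_conv_bc (\<lambda>n. distr P borel (\<lambda>\<omega>. sqrt (real n) *\<^sub>R (\<theta>h n \<omega> - \<theta>\<^sub>0))) \<nu>"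
    \<comment> \<open>the composite null hypothesis\<close>
    and H0: "m \<theta>\<^sub>0 = 0"
    \<comment> \<open>the test statistic is a random variable\<close>
    and W_meas: "\<And>n. n \<ge> 1 \<Longrightarrow> (\<lambda>\<omega>. wald_stat \<mu> f \<beta> m n (\<theta>h n \<omega>)) \<in> borel_measurable P"
    \<comment> \<open>i.i.d. standard normal variables for the limit\<close>
    and N: "prob_space N"
    and Z_indep: "prob_space.indep_vars N (\<lambda>_. borel) Z UNIV"
    and Z_distr: "\<And>i. distributed N lborel (Z i) std_normal_density"
  defines "A \<equiv> matrix_inv (congr_by m (Sigma_model \<mu> f \<beta>) \<theta>\<^sub>0)
                 ** congr_by m (Sigma_true \<mu> f \<beta> g) \<theta>\<^sub>0"
  shows "(\<exists>c. lists_eigenvalues A c) \<and>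
         (\<forall>c. lists_eigenvalues A c \<longrightarrow>
            weak_conv_m
              (\<lambda>n. distr P borel (\<lambda>\<omega>. wald_stat \<mu> f \<beta> m n (\<theta>h n \<omega>)))
              (distr N borel (\<lambda>\<omega>. \<Sum>i\<in>UNIV. c i * (Z i \<omega>)\<^sup>2)))"
proof -
  let ?S = "congr_by m (Sigma_model \<mu> f \<beta>)"
  define V where "V = (\<lambda>\<theta>. matrix_inv (?S \<theta>))"
  define M where "M = deriv_transp m \<theta>\<^sub>0"
  define T where "T = (\<lambda>n \<omega>. sqrt (real n) *\<^sub>R (\<theta>h n \<omega> - \<theta>\<^sub>0))"
  define W where "W = (\<lambda>n \<omega>. wald_stat \<mu> f \<beta> m n (\<theta>h n \<omega>))"
  define h where "h = (\<lambda>t. (transpose M *v t) \<bullet> (V \<theta>\<^sub>0 *v (transpose M *v t)))"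
  have \<theta>0: "\<theta>\<^sub>0 \<in> \<Theta>" "\<theta>\<^sub>0 \<in> U \<inter> \<Theta>"
    using theta0 nbhd by (auto simp: dpd_minimizer_def is_arg_min_def)
  have "transpose (?S \<theta>\<^sub>0) = ?S \<theta>\<^sub>0"
    by (rule transpose_congr_by, rule transpose_Sigma_model)
      (rule model_integrals_ex(2)[OF \<theta>0(2)] model_integrals_ex(3)[OF \<theta>0(2)] J_inv[OF \<theta>0(2)])+
  then have symV: "transpose (V \<theta>\<^sub>0) = V \<theta>\<^sub>0"
    using transpose_matrix_inv[OF Sigma_star_inv] by (simp add: V_def)
  obtain B :: "real^'p^'p" where B: "B ** transpose B = Sigma_true \<mu> f \<beta> g \<theta>\<^sub>0"
    and \<nu>: "\<nu> = distr (\<Pi>\<^sub>M i\<in>UNIV. std_normal_distribution) borel (\<lambda>z. 0 + B *v (\<chi> i. z i))"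
    using normal_limit unfolding multivariate_normal_def by blast
  have Bm[measurable]: "(*v) B \<in> borel_measurable borel"
    by (intro borel_measurable_continuous_onI continuous_intros)
  have \<nu>': "\<nu> = distr std_normal_vec borel ((*v) B)"
    unfolding \<nu> std_normal_vec_def by (subst distr_distr) (simp_all add: comp_def)
  define D where "D = transpose M ** B"
  have "D ** transpose D = transpose M ** (B ** transpose B) ** M"
    by (simp add: D_def matrix_transpose_mul matrix_mul_assoc)
  then have A: "A = V \<theta>\<^sub>0 ** (D ** transpose D)"
    by (simp add: A_def V_def congr_by_def M_def B)
  have hD: "h (B *v x) = (D *v x) \<bullet> (V \<theta>\<^sub>0 *v (D *v x))" for x
    by (simp add: h_def D_def matrix_vector_mul_assoc[symmetric])

  have h_cont: "continuous_on UNIV h"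
    unfolding h_def matrix_vector_mul_assoc
    by (intro continuous_on_inner linear_continuous_on matrix_vector_mul_bounded_linear)
  have T_meas: "T n \<in> borel_measurable P" for n
  proof (cases "n = 0")
    case False
    then have [measurable]: "\<theta>h n \<in> borel_measurable P" by (intro estimator(1)) simp
    show ?thesis unfolding T_def by measurable
  qed (simp add: T_def)
  have W_meas': "W n \<in> borel_measurable P" for n
    using W_meas[of n] by (cases "n = 0") (simp_all add: W_def wald_stat_def)

  \<comment> \<open>\<open>deriv_transp\<close> is the transposed Jacobian, so the derivative of \<open>m\<close> acts by its transpose.\<close>
  have m': "(m has_derivative (\<lambda>t. transpose M *v t)) (at \<theta>\<^sub>0)"
    using m_diff[OF nbhd(2)] unfolding M_def deriv_transp_def
    by (simp only: transpose_transpose jacobian_works)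
  \<comment> \<open>\<open>\<Sigma>\<^sub>\<beta>\<close> is continuous only relative to \<open>\<Theta>\<close>; this is enough, as the estimator almost surely lies in \<open>\<Theta>\<close>.\<close>
  have within: "at \<theta>\<^sub>0 within \<Theta> = at \<theta>\<^sub>0 within (U \<inter> \<Theta>)"
    by (rule at_within_nhd[OF nbhd(2,1)]) blast
  have "(deriv_transp m \<longlongrightarrow> deriv_transp m \<theta>\<^sub>0) (at \<theta>\<^sub>0)"
    using M_cont nbhd by (simp add: continuous_on_eq_continuous_at isCont_def)
  then have "(deriv_transp m \<longlongrightarrow> deriv_transp m \<theta>\<^sub>0) (at \<theta>\<^sub>0 within \<Theta>)"
    by (rule tendsto_within_subset) simp
  moreover have "(Sigma_model \<mu> f \<beta> \<longlongrightarrow> Sigma_model \<mu> f \<beta> \<theta>\<^sub>0) (at \<theta>\<^sub>0 within \<Theta>)"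
    unfolding within using Sigma_cont \<theta>0(2) by (simp add: continuous_on_def)
  ultimately have V_lim: "(V \<longlongrightarrow> V \<theta>\<^sub>0) (at \<theta>\<^sub>0 within \<Theta>)"
    unfolding V_def by (intro tendsto_matrix_inv tendsto_congr_by Sigma_star_inv)

  have "weak_conv_m (\<lambda>n. distr P borel (W n)) (distr \<nu> borel h)"
  proof (rule weak_conv_bc_imp_weak_conv_m[OF P T_meas W_meas' _ _ _ h_cont])
    show "prob_space \<nu>" "sets \<nu> = sets borel"
      unfolding \<nu>' by (auto intro!: prob_space.prob_space_distr prob_space_std_normal_vec)
    show "weak_conv_bc (\<lambda>n. distr P borel (T n)) \<nu>"
      using asymp_normal unfolding T_def .
    fix K e :: real assume "e > 0"
    from eventually_conj[OF quadratic_delta_method[OF m' H0 V_lim this, of K] eventually_ge_at_top[of 1]]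
    show "eventually (\<lambda>n. AE \<omega> in P. norm (T n \<omega>) \<le> K \<longrightarrow> \<bar>W n \<omega> - h (T n \<omega>)\<bar> \<le> e) sequentially"
    proof eventually_elim
      case (elim n)
      then have n: "n \<ge> 1" by simp
      show ?case
        using estimator(2)[OF n]
      proof eventually_elim
        case (elim \<omega>)
        have "\<theta>\<^sub>0 + T n \<omega> /\<^sub>R sqrt (real n) = \<theta>h n \<omega>"
          using n by (simp add: T_def)
        moreover have "\<theta>h n \<omega> \<in> \<Theta>"
          using elim by (simp add: dpd_minimizer_def is_arg_min_def)
        ultimately show ?case
          using conjunct1[OF \<open>_ \<and> 1 \<le> n\<close>, rule_format, of "T n \<omega>"]
          by (simp add: W_def wald_stat_def h_def V_def)
      qed
    qed
  qed
  moreover have "distr \<nu> borel h = distr std_normal_vec borel (\<lambda>x. (D *v x) \<bullet> (V \<theta>\<^sub>0 *v (D *v x)))"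
    unfolding \<nu>' using borel_measurable_continuous_onI[OF h_cont]
    by (subst distr_distr) (simp_all add: comp_def hD)
  ultimately have conv: "weak_conv_m (\<lambda>n. distr P borel (W n))
      (distr std_normal_vec borel (\<lambda>x. (D *v x) \<bullet> (V \<theta>\<^sub>0 *v (D *v x))))" by simp

  show ?thesis
  proof (intro conjI allI impI)
    show "\<exists>c. lists_eigenvalues A c"
      unfolding A by (rule quadratic_form_diagonalisation[OF symV dims, of D]) blast
  next
    fix c assume "lists_eigenvalues A c"
    then have ev: "lists_eigenvalues (V \<theta>\<^sub>0 ** (D ** transpose D)) c"
      unfolding A .
    obtain R :: "real^'p^'r" where R: "R ** transpose R = mat 1"
      "\<And>x. (D *v x) \<bullet> (V \<theta>\<^sub>0 *v (D *v x)) = (\<Sum>i\<in>UNIV. c i * ((R *v x) $ i)\<^sup>2)"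
      by (rule quadratic_form_eigenvalues[OF symV dims ev], rule that)
    show "weak_conv_m (\<lambda>n. distr P borel (\<lambda>\<omega>. wald_stat \<mu> f \<beta> m n (\<theta>h n \<omega>)))
        (distr N borel (\<lambda>\<omega>. \<Sum>i\<in>UNIV. c i * (Z i \<omega>)\<^sup>2))"
      using conv unfolding R(2) distr_weighted_squares[OF R(1) dims N Z_indep Z_distr] W_def .
  qed
qed

end
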